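(* Let $m,n,p$ and $\alpha$ be nonnegative integers, where $m,n\geq1$, $m\geq\alpha\geq1$, and $p$ is prime. Let $$\lambda:(\mathbb Z_p\cup\{0\})^n\setminus\{\boldsymbol 0\}\to\mathbb Z_p\times[m],\qquad X\mapsto(\lambda_1(X),\lambda_2(X))$$ be a $\mathbb Z_p$-equivariant map satisfying the following conditions. - For $X_1\subseteq X_2$ in $(\mathbb Z_p\cup\{0\})^n\setminus\{\boldsymbol 0\}$, if $\lambda_2(X_1)=\lambda_2(X_2)\leq\alpha$, then $\lambda_1(X_1)=\lambda_1(X_2)$. - For $X_1\subseteq X_2\subseteq\cdots\subseteq X_p$ in $(\mathbb Z_p\cup\{0\})^n\setminus\{\boldsymbol 0\}$, if $\lambda_2(X_1)=\lambda_2(X_2)=\cdots=\lambda_2(X_p)\geq\alpha+1$, then $|\{\lambda_1(X_1),\lambda_1(X_2),\ldots,\lambda_1(X_p)\}|<p$. Then there is a chain $Z_1\subset Z_2\subset\cdots\subset Z_{n-\alpha}$ in $(\mathbb Z_p\cup\{0\})^n\setminus\{\boldsymbol 0\}$ such that 1. for each $i\in[n-\alpha]$, $\lambda_2(Z_i)\geq\alpha+1$; 2. for each $i\neq j\in[n-\alpha]$, $\lambda(Z_i)\neq\lambda(Z_j)$; and 3. for each $\epsilon\in\mathbb Z_p$, $$\left\lfloor\frac{n-\alpha}{p}\right\rfloor\leq|\{j:\lambda_1(Z_j)=\epsilon\}|\leq\left\lceil\frac{n-\alpha}{p}\right\rceil.$$ In particular, $n-\alpha\leq(p-1)(m-\a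lpha)$.
   Context: $\mathbb Z_p=\{\omega,\omega^2,\dots,\omega^p\}$ is the (multiplicatively written) cyclic group of order $p$ with generator $\omega$, and $0$ is an extra symbol. For $X=(x_1,\dots,x_n)\in(\mathbb Z_p\cup\{0\})^n$ and $\epsilon\in\mathbb Z_p$, $X^\epsilon=\{i\in[n]:x_i=\epsilon\}$; $X\subseteq Y$ means $X^\epsilon\subseteq Y^\epsilon$ for all $\epsilon\in\mathbb Z_p$. $\boldsymbol 0$ is the all-zero vector. $\mathbb Z_p$ acts on vectors coordinatewise by multiplication (with $\epsilon\cdot0=0$) and on $\mathbb Z_p\times[m]$ by $\epsilon\cdot(\epsilon',j)=(\epsilon\epsilon',j)$; equivariant means $\lambda(\epsilon\cdot X)=\epsilon\cdot\lambda(X)$. *)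

theory Defs
  imports Complex_Main "HOL-Computational_Algebra.Primes" "HOL-Algebra.Elementary_Groups"
begin

(* A vector over the carrier of G with an extra zero is an extensional function on {1..n}
   with values in 'a option: None is the symbol 0, and Some e is the group element e. *)

definition signed_vectors :: "('a, 'b) monoid_scheme \<Rightarrow> nat \<Rightarrow> (nat \<Rightarrow> 'a option) set" where
  "signed_vectors G n = {1..n} \<rightarrow>\<^sub>E insert None (Some ` carrier G)"

definition zero_vector :: "nat \<Rightarrow> nat \<Rightarrow> 'a option" where
  "zero_vector n = (\<lambda>i\<in>{1..n}. None)"

definition nonzero_vectors :: "('a, 'b) monoid_scheme \<Rightarrow> nat \<Rightarrow> (nat \<Rightarrow> 'a option) set" where
  "nonzero_vectors G n = signed_vectors G n - {zero_vector n}"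

definition sign_class :: "nat \<Rightarrow> (nat \<Rightarrow> 'a option) \<Rightarrow> 'a \<Rightarrow> nat set" where
  "sign_class n X e = {i \<in> {1..n}. X i = Some e}"

definition vec_subseteq ::
  "('a, 'b) monoid_scheme \<Rightarrow> nat \<Rightarrow> (nat \<Rightarrow> 'a option) \<Rightarrow> (nat \<Rightarrow> 'a option) \<Rightarrow> bool" where
  "vec_subseteq G n X Y \<longleftrightarrow> (\<forall>e \<in> carrier G. sign_class n X e \<subseteq> sign_class n Y e)"

definition vec_subset ::
  "('a, 'b) monoid_scheme \<Rightarrow> nat \<Rightarrow> (nat \<Rightarrow> 'a option) \<Rightarrow> (nat \<Rightarrow> 'a option) \<Rightarrow> bool" where
  "vec_subset G n X Y \<longleftrightarrow> vec_subseteq G n X Y \<and> X \<noteq> Y"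

definition vec_act ::
  "('a, 'b) monoid_scheme \<Rightarrow> nat \<Rightarrow> 'a \<Rightarrow> (nat \<Rightarrow> 'a option) \<Rightarrow> (nat \<Rightarrow> 'a option)" where
  "vec_act G n e X = (\<lambda>i\<in>{1..n}. map_option (\<lambda>x. e \<otimes>\<^bsub>G\<^esub> x) (X i))"

definition label_act :: "('a, 'b) monoid_scheme \<Rightarrow> 'a \<Rightarrow> 'a \<times> nat \<Rightarrow> 'a \<times> nat" where
  "label_act G e l = (e \<otimes>\<^bsub>G\<^esub> fst l, snd l)"

definition equivariant ::
  "('a, 'b) monoid_scheme \<Rightarrow> nat \<Rightarrow> ((nat \<Rightarrow> 'a option) \<Rightarrow> 'a \<times> nat) \<Rightarrow> bool" where
  "equivariant G n f \<longleftrightarrow>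
     (\<forall>e \<in> carrier G. \<forall>X \<in> nonzero_vectors G n. f (vec_act G n e X) = label_act G e (f X))"

end

theory Submission
  imports Defs "HOL-Library.Poly_Mapping" "HOL-Algebra.Multiplicative_Group"
begin

text \<open>
  If \<open>n \<le> \<alpha>\<close>, the chain is empty, so let \<open>\<alpha> < n\<close>. Suppose that no chain \<open>Z\<close> with the
  required balance exists, and consider a chain \<open>V\<close> of nonzero vectors. Its set of labels \<open>\<tau> = lam ` V\<close>
  then contains no balanced set of \<open>n - \<alpha>\<close> labels with second component above \<open>\<alpha>\<close>,
  because such a set could be read off along \<open>V\<close> as a chain \<open>Z\<close>. Thus the
  largest size \<open>v(\<tau>)\<close> of a balanced set of high labels is less than \<open>n - \<alpha>\<close>. The \<open>level\<close> of \<open>\<tau>\<close> is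
  \<open>\<alpha> + v(\<tau>)\<close>, or the largest second component if no label is high. It is one of \<open>1, \<dots>, n - 1\<close>
  and it grows with \<open>\<tau>\<close>. The level comes with a \<open>core\<close>, a set canonically attached to \<open>\<tau>\<close> that is
  the same for comparable label sets of equal level and that no rotation fixes: the two
  hypotheses on \<open>lam\<close> imply that \<open>\<tau>\<close> never contains all signs above one second component. As \<open>p\<close> is
  prime, rotations act freely on such sets, so a core can be given a sign in \<open>\<int> / p\<close> in an equivariant
  way (\<open>free_action_coordinate\<close>). Level and sign together map the poset of chains of vectors
  monotonically to the join of \<open>n - 1\<close> copies of \<open>\<int> / p\<close>, and the sign is equivariant
  (\<open>level_mono\<close>, \<open>core_partial\<close>, \<open>core_map\<close>).

  Such a map does not exist (\<open>no_equivariant_labelling\<close>). A nonzero vector is a chain in the poset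
  \<open>{1..n} \<times> \<int> / p\<close> whose order complex is the join of \<open>n\<close> copies of \<open>\<int> / p\<close>, so the source is the
  poset of faces of a barycentric subdivision of this join, and this is an instance of Dold's theorem.
  The proof here is by chains. In the join of \<open>n\<close> copies there are chains \<open>x\<^sub>1, \<dots>, x\<^sub>n\<close>, with \<open>x\<^sub>k\<close> of
  dimension \<open>k - 1\<close>, whose boundaries are \<open>\<partial> x\<^sub>k\<^sub>+\<^sub>1 = (s - 1) x\<^sub>k\<close> for odd \<open>k\<close> and
  \<open>\<partial> x\<^sub>k\<^sub>+\<^sub>1 = (1 + s + \<dots> + s\<^sup>p\<^sup>-\<^sup>1) x\<^sub>k\<close> for even \<open>k\<close>, where \<open>s\<close> is the rotation
  (\<open>resolution_chains_join\<close>). Barycentric subdivision and equivariant maps carry such a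
  sequence to another one. Evaluation on explicit cochains that depend only on signs gives every member
  of such a sequence the degree \<open>1\<close> modulo \<open>p\<close> (\<open>degree_of_resolution\<close>). But the target has dimension
  \<open>n - 2\<close>, hence the image of \<open>x\<^sub>n\<close> is degenerate and has degree \<open>0\<close>.

  For the final inequality, the \<open>n - \<alpha>\<close> distinct labels along \<open>Z\<close> have second components in
  \<open>{\<alpha> + 1..m}\<close>, and every second component occurs with at most \<open>p - 1\<close> signs.
\<close>

section \<open>Ordered simplicial chains and subdivision\<close>

text \<open>A simplicial chain is a formal integer combination of lists of vertices. The order in a list
  serves as orientation, and repeated vertices are kept, so that a vertex map induces a chain map
  without any sign or case distinction. The empty list is the simplex of dimension \<open>-1\<close>, which
  makes the complex augmented; a list of length \<open>k\<close> has dimension \<open>k - 1\<close>.\<close>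

definition cone :: "'v \<Rightarrow> ('v list \<Rightarrow>\<^sub>0 int) \<Rightarrow> ('v list \<Rightarrow>\<^sub>0 int)" where
  "cone v = frag_extend (\<lambda>l. frag_of (v # l))"

primrec list_boundary :: "'v list \<Rightarrow> ('v list \<Rightarrow>\<^sub>0 int)" where
  "list_boundary [] = 0"
| "list_boundary (v # l) = frag_of l - cone v (list_boundary l)"

definition boundary :: "('v list \<Rightarrow>\<^sub>0 int) \<Rightarrow> ('v list \<Rightarrow>\<^sub>0 int)" where
  "boundary = frag_extend list_boundary"

definition push :: "('v \<Rightarrow> 'w) \<Rightarrow> ('v list \<Rightarrow>\<^sub>0 int) \<Rightarrow> ('w list \<Rightarrow>\<^sub>0 int)" where
  "push f = frag_extend (\<lambda>l. frag_of (map f l))"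

lemma cone_simps [simp]:
  "cone v 0 = 0" "cone v (frag_of l) = frag_of (v # l)" "cone v (x - y) = cone v x - cone v y"
  by (simp_all add: cone_def frag_extend_diff)

lemma boundary_simps [simp]:
  "boundary 0 = 0" "boundary (frag_of l) = list_boundary l"
  "boundary (x - y) = boundary x - boundary y"
  by (simp_all add: boundary_def frag_extend_diff)

lemma push_simps [simp]:
  "push f 0 = 0" "push f (frag_of l) = frag_of (map f l)" "push f (x - y) = push f x - push f y"
  by (simp_all add: push_def frag_extend_diff)

lemma push_sum: "finite I \<Longrightarrow> push f (\<Sum>i\<in>I. x i) = (\<Sum>i\<in>I. push f (x i))"
  by (simp add: push_def frag_extend_sum o_def)

text \<open>This is why coning fills cycles: if \<open>boundary x = 0\<close>, then \<open>x\<close> is the boundary of its cone.\<close>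

lemma boundary_cone: "boundary (cone v x) = x - cone v (boundary x)"
  using subset_UNIV by (induction x rule: frag_induction) (simp_all add: algebra_simps)

lemma boundary_list_boundary [simp]: "boundary (list_boundary l) = 0"
  by (induction l) (simp_all add: boundary_cone)

lemma push_cone: "push f (cone v x) = cone (f v) (push f x)"
  using subset_UNIV by (induction x rule: frag_induction) simp_all

lemma push_list_boundary: "push f (list_boundary l) = list_boundary (map f l)"
  by (induction l) (simp_all add: push_cone)

lemma boundary_push: "boundary (push f x) = push f (boundary x)"
  using subset_UNIV by (induction x rule: frag_induction) (simp_all add: push_list_boundary)

lemma push_push: "push f (push g x) = push (f \<circ> g) x"
  using subset_UNIV by (induction x rule: frag_induction) (simp_all add: o_def)

lemma push_cong:
  assumes "\<And>l v. l \<in> Poly_Mapping.keys x \<Longrightarrow> v \<in> set l \<Longrightarrow> f v = g v"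
  shows "push f x = push g x"
  unfolding push_def by (rule frag_extend_eq) (use assms in \<open>simp cong: map_cong\<close>)

lemma push_id [simp]: "push (\<lambda>v. v) x = x"
  using subset_UNIV by (induction x rule: frag_induction) simp_all

lemma keys_cone: "Poly_Mapping.keys (cone v x) \<subseteq> Cons v ` Poly_Mapping.keys x"
  unfolding cone_def using keys_frag_extend by fastforce

lemma keys_push: "Poly_Mapping.keys (push f x) \<subseteq> map f ` Poly_Mapping.keys x"
  unfolding push_def using keys_frag_extend by fastforce

lemma keys_list_boundary:
  "c \<in> Poly_Mapping.keys (list_boundary l) \<Longrightarrow> set c \<subseteq> set l \<and> Suc (length c) = length l"
proof (induction l arbitrary: c)
  case (Cons v l)
  then have "c = l \<or> c \<in> Cons v ` Poly_Mapping.keys (list_boundary l)"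
    using keys_diff[of "frag_of l" "cone v (list_boundary l)"] keys_cone[of v "list_boundary l"]
    by auto
  then show ?case using Cons.IH by fastforce
qed simp

text \<open>Barycentric subdivision: a simplex is the cone, from its barycentre \<open>set l\<close>, over its
  subdivided boundary. The first argument is the number of vertices and makes the recursion
  primitive.\<close>

primrec subdivide :: "nat \<Rightarrow> 'v list \<Rightarrow> ('v set list \<Rightarrow>\<^sub>0 int)" where
  "subdivide 0 l = frag_of []"
| "subdivide (Suc k) l = cone (set l) (frag_extend (subdivide k) (list_boundary l))"

text \<open>The subdivided boundary of a simplex is again a cycle, by induction on the dimension, and
  the cone over a cycle has this cycle as its boundary.\<close>

lemma boundary_subdivide:
  assumes "Poly_Mapping.keys x \<subseteq> {c. length c = Suc k}"
  shows "boundary (frag_extend (subdivide (Suc k)) x) = frag_extend (subdivide k) (boundary x)"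
  using assms
proof (induction k arbitrary: x)
  case 0
  have const: "boundary (frag_extend (subdivide 0) y) = 0" for y :: "'a list \<Rightarrow>\<^sub>0 int"
    using subset_UNIV by (induction y rule: frag_induction) (simp_all add: frag_extend_diff)
  from 0 show ?case
  proof (induction x rule: frag_induction)
    case (one c)
    show ?case
      by (simp only: frag_extend_of subdivide.simps(2) boundary_cone const boundary_simps cone_simps
          diff_zero)
  qed (simp_all add: frag_extend_diff del: subdivide.simps)
next
  case (Suc k)
  from Suc.prems show ?case
  proof (induction x rule: frag_induction)
    case (one c)
    have "Poly_Mapping.keys (list_boundary c) \<subseteq> {b. length b = Suc k}"
      using keys_list_boundary one by fastforce
    from Suc.IH[OF this]
    have cycle: "boundary (frag_extend (subdivide (Suc k)) (list_boundary c)) = 0"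
      by (simp only: boundary_list_boundary frag_extend_0)
    show ?case
      by (simp only: frag_extend_of subdivide.simps(2)[of "Suc k"] boundary_cone cycle boundary_simps
          cone_simps diff_zero)
  qed (simp_all add: frag_extend_diff del: subdivide.simps)
qed

lemma subdivide_push:
  "frag_extend (subdivide k) (push f x) = push (image f) (frag_extend (subdivide k) x)"
proof (induction k arbitrary: x)
  case 0
  show ?case
    using subset_UNIV by (induction x rule: frag_induction) (simp_all add: frag_extend_diff)
next
  case (Suc k)
  show ?case
    using subset_UNIV
  proof (induction x rule: frag_induction)
    case (one c)
    show ?case by (simp add: push_cone Suc.IH flip: push_list_boundary)
  qed (simp_all add: frag_extend_diff del: subdivide.simps)
qed

lemma keys_subdivide:
  "length l = k \<Longrightarrow> c \<in> Poly_Mapping.keys (subdivide k l) \<Longrightarrow>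
     length c = k \<and> sorted_wrt (\<supseteq>) c \<and> (\<forall>s \<in> set c. s \<noteq> {} \<and> s \<subseteq> set l)"
proof (induction k arbitrary: l c)
  case (Suc k)
  from Suc.prems(2) obtain c' where c: "c = set l # c'"
      and "c' \<in> Poly_Mapping.keys (frag_extend (subdivide k) (list_boundary l))"
    using keys_cone by fastforce
  then obtain b where b: "b \<in> Poly_Mapping.keys (list_boundary l)"
      and c': "c' \<in> Poly_Mapping.keys (subdivide k b)"
    using keys_frag_extend[of "subdivide k" "list_boundary l"] by auto
  have "length b = k" "set b \<subseteq> set l" using keys_list_boundary[OF b] Suc.prems(1) by auto
  with Suc.IH[OF _ c'] show ?case using c Suc.prems(1) by fastforce
qed simp

section \<open>Chains that realise the periodic resolution\<close>

text \<open>For a vertex map \<open>s\<close> of order \<open>p\<close>, the maps \<open>s - 1\<close> and \<open>1 + s + \<dots> + s\<^sup>p\<^sup>-\<^sup>1\<close> alternate in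
  the periodic free resolution of the integers over the group ring of \<open>\<int> / p\<close>. The index \<open>k\<close> is
  the number of vertices of the simplices involved.\<close>

definition differential :: "nat \<Rightarrow> ('v \<Rightarrow> 'v) \<Rightarrow> nat \<Rightarrow> ('v list \<Rightarrow>\<^sub>0 int) \<Rightarrow> ('v list \<Rightarrow>\<^sub>0 int)" where
  "differential p s k x = (if odd k then push s x - x else \<Sum>j<p. push (s ^^ j) x)"

text \<open>The images of the generators of the periodic resolution under an equivariant chain map, in
  the dimensions \<open>0, \<dots>, n - 1\<close>. The equation \<open>boundary (X 1) = frag_of []\<close> says that the \<open>0\<close>-chain
  has augmentation \<open>1\<close>. The set \<open>L\<close> records which simplices occur.\<close>

definition resolution_chains ::
  "nat \<Rightarrow> ('v \<Rightarrow> 'v) \<Rightarrow> nat \<Rightarrow> 'v list set \<Rightarrow> (nat \<Rightarrow> ('v list \<Rightarrow>\<^sub>0 int)) \<Rightarrow> bool" where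
  "resolution_chains p s n L X \<longleftrightarrow>
     boundary (X 1) = frag_of [] \<and>
     (\<forall>k \<in> {1..<n}. boundary (X (Suc k)) = differential p s k (X k)) \<and>
     (\<forall>k \<in> {1..n}. Poly_Mapping.keys (X k) \<subseteq> {l \<in> L. length l = k})"

lemma resolution_chains_mono:
  "resolution_chains p s n L X \<Longrightarrow> L \<subseteq> L' \<Longrightarrow> resolution_chains p s n L' X"
  unfolding resolution_chains_def by (simp add: subset_iff)

lemma image_funpow:
  fixes s :: "'v \<Rightarrow> 'v"
  shows "image (s ^^ j) = image s ^^ j"
proof (induction j)
  case (Suc j)
  have "image (s ^^ Suc j) = image s \<circ> image (s ^^ j)" by (simp add: fun_eq_iff image_image)
  then show ?case by (simp only: Suc funpow.simps(2))
qed (simp add: fun_eq_iff)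

lemma subdivide_differential:
  "frag_extend (subdivide k) (differential p s i x) = differential p (image s) i (frag_extend (subdivide k) x)"
  by (simp add: differential_def frag_extend_diff frag_extend_sum o_def
      subdivide_push image_funpow)

lemma resolution_chains_subdivide:
  assumes "resolution_chains p s n L X" and "n \<ge> 1"
  shows "resolution_chains p (image s) n
           {c. sorted_wrt (\<supseteq>) c \<and> (\<exists>l\<in>L. \<forall>t\<in>set c. t \<noteq> {} \<and> t \<subseteq> set l)}
           (\<lambda>k. frag_extend (subdivide k) (X k))"
  unfolding resolution_chains_def
proof (intro conjI ballI)
  have keys: "Poly_Mapping.keys (X k) \<subseteq> {l \<in> L. length l = k}" if "k \<in> {1..n}" for k
    using assms that unfolding resolution_chains_def by blast
  have X1: "boundary (X 1) = frag_of []"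
    using assms unfolding resolution_chains_def by blast
  have "boundary (frag_extend (subdivide (Suc 0)) (X (Suc 0)))
          = frag_extend (subdivide 0) (boundary (X (Suc 0)))"
    by (rule boundary_subdivide) (use keys[of 1] \<open>n \<ge> 1\<close> in auto)
  also have "\<dots> = frag_of []" using X1 by simp
  finally show "boundary (frag_extend (subdivide 1) (X 1)) = frag_of []" by simp
  fix k
  show "boundary (frag_extend (subdivide (Suc k)) (X (Suc k)))
          = differential p (image s) k (frag_extend (subdivide k) (X k))" if "k \<in> {1..<n}"
  proof -
    have "boundary (frag_extend (subdivide (Suc k)) (X (Suc k)))
            = frag_extend (subdivide k) (boundary (X (Suc k)))"
      by (rule boundary_subdivide) (use keys[of "Suc k"] that in auto)
    then show ?thesis
      using assms that by (simp add: resolution_chains_def subdivide_differential)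
  qed
  show "Poly_Mapping.keys (frag_extend (subdivide k) (X k)) \<subseteq>
     {c \<in> {c. sorted_wrt (\<supseteq>) c \<and> (\<exists>l\<in>L. \<forall>t\<in>set c. t \<noteq> {} \<and> t \<subseteq> set l)}. length c = k}"
    if "k \<in> {1..n}"
  proof
    fix c assume "c \<in> Poly_Mapping.keys (frag_extend (subdivide k) (X k))"
    then obtain l where "l \<in> Poly_Mapping.keys (X k)" "c \<in> Poly_Mapping.keys (subdivide k l)"
      using keys_frag_extend[of "subdivide k" "X k"] by auto
    then show "c \<in> {c \<in> {c. sorted_wrt (\<supseteq>) c \<and> (\<exists>l\<in>L. \<forall>t\<in>set c. t \<noteq> {} \<and> t \<subseteq> set l)}. length c = k}"
      using keys[OF that] keys_subdivide[of l k c] by blast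
  qed
qed

text \<open>Equivariance of \<open>f\<close> is demanded only on an invariant set \<open>A\<close> that contains all vertices in
  use, since the maps of interest behave well only on chains of sign vectors.\<close>

lemma resolution_chains_push:
  assumes "resolution_chains p s n L X"
    and L: "L \<subseteq> lists A"
    and inv: "\<And>v. v \<in> A \<Longrightarrow> s v \<in> A"
    and eq: "\<And>v. v \<in> A \<Longrightarrow> f (s v) = s' (f v)"
  shows "resolution_chains p s' n (map f ` L) (\<lambda>k. push f (X k))"
proof -
  have keys: "Poly_Mapping.keys (X k) \<subseteq> {l \<in> L. length l = k}" if "k \<in> {1..n}" for k
    using assms(1) that unfolding resolution_chains_def by blast
  have pow: "(s ^^ j) v \<in> A \<and> f ((s ^^ j) v) = (s' ^^ j) (f v)" if "v \<in> A" for j v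
    using that by (induction j) (auto simp: inv eq)
  have push_pow: "push f (push (s ^^ j) (X k)) = push (s' ^^ j) (push f (X k))" if "k \<in> {1..n}" for j k
    unfolding push_push
    by (rule push_cong) (use keys[OF that] L pow in auto)
  have push_one: "push f (push s (X k)) = push s' (push f (X k))" if "k \<in> {1..n}" for k
    unfolding push_push
    by (rule push_cong) (use keys[OF that] L eq in auto)
  have "push f (differential p s k (X k)) = differential p s' k (push f (X k))" if "k \<in> {1..n}" for k
    using that by (simp add: differential_def push_sum push_pow push_one)
  moreover have "Poly_Mapping.keys (push f (X k)) \<subseteq> {l \<in> map f ` L. length l = k}"
    if "k \<in> {1..n}" for k
  proof -
    have "map f ` Poly_Mapping.keys (X k) \<subseteq> {l \<in> map f ` L. length l = k}"
      using keys[OF that] by auto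
    with keys_push show ?thesis by (rule order_trans)
  qed
  ultimately show ?thesis
    using assms(1) unfolding resolution_chains_def by (simp add: boundary_push)
qed

lemma boundary_sum: "finite I \<Longrightarrow> boundary (\<Sum>i\<in>I. x i) = (\<Sum>i\<in>I. boundary (x i))"
  by (simp add: boundary_def frag_extend_sum o_def)

lemma boundary_differential: "boundary (differential p s k x) = differential p s k (boundary x)"
  by (simp add: differential_def boundary_sum boundary_push)

text \<open>In the group ring, \<open>(s - 1) (1 + s + \<dots> + s\<^sup>p\<^sup>-\<^sup>1) = s\<^sup>p - 1\<close>; the sum telescopes.\<close>

lemma differential_differential:
  assumes "push (s ^^ p) x = x"
  shows "differential p s (Suc k) (differential p s k x) = 0"
proof -
  have "(\<Sum>j<p. push (s ^^ Suc j) x - push (s ^^ j) x) = 0"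
    using assms by (subst sum_lessThan_telescope) (simp add: id_def)
  moreover have "push (s ^^ j) (push s x) = push (s ^^ Suc j) x"
    and "push s (push (s ^^ j) x) = push (s ^^ Suc j) x" for j
    by (simp_all add: push_push funpow_swap1 o_def)
  ultimately show ?thesis
    by (simp add: differential_def push_sum sum_subtractf del: funpow.simps)
qed

lemma keys_differential:
  assumes "Poly_Mapping.keys x \<subseteq> K" and "\<And>l. l \<in> K \<Longrightarrow> map s l \<in> K"
  shows "Poly_Mapping.keys (differential p s k x) \<subseteq> K"
proof -
  have pow: "map (s ^^ j) l \<in> K" if "l \<in> K" for j l
    using that
  proof (induction j)
    case (Suc j)
    then show ?case using assms(2)[of "map (s ^^ j) l"] by (simp add: o_def)
  qed simp
  have "Poly_Mapping.keys (push (s ^^ j) x) \<subseteq> K" for j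
    using keys_push[of "s ^^ j" x] assms(1) pow by blast
  moreover have "Poly_Mapping.keys (push s x) \<subseteq> K"
    using keys_push[of s x] assms by blast
  ultimately show ?thesis
    using keys_diff[of "push s x" x] assms(1)
      keys_sum[of "\<lambda>j. push (s ^^ j) x" "{..<p}"]
    unfolding differential_def by (cases "odd k") (simp_all, blast+)
qed

text \<open>In the join of the sets \<open>{k} \<times> E\<close>, the cycle \<open>differential p s k\<close> of the previous chain
  lives in the first \<open>k\<close> factors and is filled by coning with a point of factor \<open>k + 1\<close>. The cone
  point is put in front, so the lists are decreasing in the first component. The first chain is
  treated apart: it is a single point, and its boundary is the empty simplex rather than a
  differential of it.\<close>

primrec join_chain :: "nat \<Rightarrow> ('a \<Rightarrow> 'a) \<Rightarrow> 'a \<Rightarrow> nat \<Rightarrow> ((nat \<times> 'a) list \<Rightarrow>\<^sub>0 int)" where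
  "join_chain p w e 0 = frag_of []"
| "join_chain p w e (Suc k) = cone (Suc k, e)
     (if k = 0 then frag_of [] else differential p (map_prod id w) k (join_chain p w e k))"

lemma map_prod_funpow:
  fixes w :: "'a \<Rightarrow> 'a"
  shows "map_prod id w ^^ j = map_prod id (w ^^ j)"
  by (induction j) (auto simp: fun_eq_iff)

lemma keys_join_chain:
  assumes "e \<in> E" and w: "\<And>a. a \<in> E \<Longrightarrow> w a \<in> E"
  shows "Poly_Mapping.keys (join_chain p w e k) \<subseteq>
    {l. length l = k \<and> sorted_wrt (\<lambda>x y. fst y < fst x) l \<and> set l \<subseteq> {1..k} \<times> E}"
proof (induction k)
  case (Suc k)
  let ?K = "{l. length l = k \<and> sorted_wrt (\<lambda>x y. fst y < fst x) l \<and> set l \<subseteq> {1..k} \<times> E}"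
  let ?x = "if k = 0 then frag_of [] else differential p (map_prod id w) k (join_chain p w e k)"
  have "Poly_Mapping.keys (differential p (map_prod id w) k (join_chain p w e k)) \<subseteq> ?K"
    by (rule keys_differential[OF Suc.IH]) (use w in \<open>auto simp: sorted_wrt_map\<close>)
  then have "Poly_Mapping.keys ?x \<subseteq> ?K" by auto
  then have "Poly_Mapping.keys (join_chain p w e (Suc k)) \<subseteq> Cons (Suc k, e) ` ?K"
    unfolding join_chain.simps by (rule order_trans[OF keys_cone image_mono])
  also have "\<dots> \<subseteq> {l. length l = Suc k \<and> sorted_wrt (\<lambda>x y. fst y < fst x) l
      \<and> set l \<subseteq> {1..Suc k} \<times> E}"
    using \<open>e \<in> E\<close> by fastforce
  finally show ?case .
qed simp

lemma resolution_chains_join: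
  assumes E: "e \<in> E" "\<And>a. a \<in> E \<Longrightarrow> w a \<in> E" and order: "\<And>a. a \<in> E \<Longrightarrow> (w ^^ p) a = a"
  shows "resolution_chains p (map_prod id w) n
    {l. sorted_wrt (\<lambda>x y. fst y < fst x) l \<and> set l \<subseteq> {1..n} \<times> E} (join_chain p w e)"
proof -
  let ?s = "map_prod id w" and ?X = "join_chain p w e"
  have keys: "Poly_Mapping.keys (?X k) \<subseteq>
      {l. length l = k \<and> sorted_wrt (\<lambda>x y. fst y < fst x) l \<and> set l \<subseteq> {1..k} \<times> E}" for k
    by (rule keys_join_chain) (use E in auto)
  have period: "push (?s ^^ p) (?X k) = ?X k" for k
  proof -
    have "push (?s ^^ p) (?X k) = push (\<lambda>v. v) (?X k)"
      by (rule push_cong) (use keys order in \<open>fastforce simp: map_prod_funpow\<close>)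
    then show ?thesis by simp
  qed
  have X1: "boundary (?X 1) = frag_of []" by (simp add: boundary_cone)
  have bd: "boundary (?X (Suc k)) = differential p ?s k (?X k)" if "k \<ge> 1" for k
    using that
  proof (induction k rule: dec_induct)
    case base
    show ?case by (simp add: boundary_cone differential_def)
  next
    case (step k)
    have "boundary (differential p ?s (Suc k) (?X (Suc k))) = differential p ?s (Suc k) (differential p ?s k (?X k))"
      using step by (simp only: boundary_differential)
    also have "\<dots> = 0" by (rule differential_differential[OF period])
    finally show ?case
      by (subst join_chain.simps(2)) (simp add: boundary_cone del: join_chain.simps)
  qed
  have "Poly_Mapping.keys (?X k) \<subseteq>
      {l \<in> {l. sorted_wrt (\<lambda>x y. fst y < fst x) l \<and> set l \<subseteq> {1..n} \<times> E}. length l = k}"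
    if "k \<in> {1..n}" for k
    using keys[of k] that by fastforce
  then show ?thesis
    unfolding resolution_chains_def using bd X1 by (simp del: join_chain.simps)
qed

section \<open>Cochains that detect the degree modulo p\<close>

text \<open>Cochains are integer functions on simplices, extended linearly to chains.\<close>

definition evaluate :: "('c \<Rightarrow> int) \<Rightarrow> ('c \<Rightarrow>\<^sub>0 int) \<Rightarrow> int" where
  "evaluate a x = (\<Sum>c \<in> Poly_Mapping.keys x. Poly_Mapping.lookup x c * a c)"

lemma evaluate_eq_lookup:
  "evaluate a x = Poly_Mapping.lookup (frag_extend (\<lambda>c. frag_cmul (a c) (frag_of ())) x) ()"
  by (simp add: evaluate_def frag_extend_def lookup_sum)

lemma evaluate_simps [simp]:
  "evaluate a 0 = 0" "evaluate a (frag_of c) = a c"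
  "evaluate a (x - y) = evaluate a x - evaluate a y"
  by (simp_all add: evaluate_eq_lookup frag_extend_diff lookup_minus)

lemma evaluate_sum: "finite I \<Longrightarrow> evaluate a (\<Sum>i\<in>I. x i) = (\<Sum>i\<in>I. evaluate a (x i))"
  by (simp add: evaluate_eq_lookup frag_extend_sum lookup_sum)

lemma evaluate_cong: "(\<And>c. c \<in> Poly_Mapping.keys x \<Longrightarrow> a c = b c) \<Longrightarrow> evaluate a x = evaluate b x"
  by (simp add: evaluate_def)

lemma evaluate_diff_left: "evaluate (\<lambda>c. a c - b c) x = evaluate a x - evaluate b x"
  by (simp add: evaluate_def algebra_simps sum_subtractf)

lemma evaluate_sum_left: "evaluate (\<lambda>c. \<Sum>i\<in>I. a i c) x = (\<Sum>i\<in>I. evaluate (a i) x)"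
  by (simp add: evaluate_def sum_distrib_left) (rule sum.swap)

lemma evaluate_push: "evaluate a (push f x) = evaluate (\<lambda>l. a (map f l)) x"
  using subset_UNIV by (induction x rule: frag_induction) simp_all

lemma evaluate_cone: "evaluate a (cone v x) = evaluate (\<lambda>l. a (v # l)) x"
  using subset_UNIV by (induction x rule: frag_induction) simp_all

definition coboundary :: "('v list \<Rightarrow> int) \<Rightarrow> 'v list \<Rightarrow> int" where
  "coboundary a l = evaluate a (list_boundary l)"

lemma coboundary_simps [simp]:
  "coboundary a [] = 0"
  "coboundary a (v # l) = a l - coboundary (\<lambda>c. a (v # c)) l"
  by (simp_all add: coboundary_def evaluate_cone)

lemma evaluate_coboundary: "evaluate (coboundary a) x = evaluate a (boundary x)"
  using subset_UNIV by (induction x rule: frag_induction) (simp_all add: coboundary_def)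

lemma coboundary_mult: "coboundary (\<lambda>c. k * a c) l = k * coboundary a l"
  by (simp add: coboundary_def evaluate_def sum_distrib_left mult_ac)

text \<open>Vertices are now the numbers \<open>0, \<dots>, p - 1\<close>, rotated by \<open>t \<mapsto> t + 1\<close> modulo \<open>p\<close>. A descent
  compares \<open>a\<close> and \<open>b\<close> as integers, hence it changes under rotation exactly when one of them wraps
  around and the other does not (\<open>descent_rotate\<close>). Its coboundary
  \<open>descent a b + descent b c - descent a c\<close> is a rotation invariant \<open>2\<close>-cocycle, and \<open>winding\<close> is
  the cup power of this cocycle on simplices of even dimension.\<close>

definition descent :: "nat \<Rightarrow> nat \<Rightarrow> int" where
  "descent a b = of_bool (b < a)"

fun winding :: "nat list \<Rightarrow> int" where
  "winding (a # b # c # l) = (descent a b + descent b c - descent a c) * winding (c # l)"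
| "winding _ = 1"

text \<open>In even dimension, \<open>even_cochain\<close> is the part of \<open>winding\<close> on simplices whose first vertex
  is \<open>p - 1\<close>, so its rotations add up to \<open>winding\<close>. In odd dimension, \<open>odd_cochain\<close> is the cup
  product of \<open>descent\<close> with \<open>winding\<close>. These cochains mirror the resolution: the coboundary of the
  even one is the rotation difference of the odd one (\<open>coboundary_even_cochain\<close>), and the
  coboundary of the odd one is the sum of the rotations of the next even one
  (\<open>coboundary_odd_cochain\<close> with \<open>sum_even_cochain\<close>).\<close>

definition even_cochain :: "nat \<Rightarrow> nat list \<Rightarrow> int" where
  "even_cochain p l = of_bool (hd l = p - 1) * winding l"

fun odd_cochain :: "nat list \<Rightarrow> int" where
  "odd_cochain (a # b # l) = descent a b * winding (b # l)"
| "odd_cochain _ = 0"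

text \<open>A cup power of a cocycle is a cocycle. The factor \<open>descent a b + descent b c - descent a c\<close>
  is a coboundary, so its alternating sum over the faces of the first four vertices vanishes, and
  the rest of the list is covered by induction.\<close>

lemma coboundary_winding: "even (length l) \<Longrightarrow> coboundary winding l = 0"
proof (induction l rule: winding.induct)
  case (1 a b c l)
  then obtain d l' where l: "l = d # l'" by (cases l) auto
  have IH: "coboundary (\<lambda>r. winding (c # r)) l = winding l"
    using "1.IH" "1.prems" by simp
  have "coboundary (\<lambda>r. winding (a # b # c # r)) l
        = (descent a b + descent b c - descent a c) * winding l"
    by (simp add: coboundary_mult IH)
  then show ?case by (simp add: l algebra_simps)
qed (auto simp: numeral_2_eq_2)

lemma coboundary_odd_cochain:
  assumes "odd (length l)" and "length l \<ge> 3"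
  shows "coboundary odd_cochain l = winding l"
proof -
  obtain a b c r where l: "l = a # b # c # r"
    using assms(2) by (auto simp: numeral_3_eq_3 Suc_le_length_iff)
  have "coboundary (\<lambda>x. winding (b # x)) (c # r) = winding (c # r)"
    using coboundary_winding[of "b # c # r"] assms(1) l by simp
  then have "coboundary (\<lambda>x. odd_cochain (a # b # x)) (c # r) = descent a b * winding (c # r)"
    by (simp only: odd_cochain.simps coboundary_mult)
  then show ?thesis by (simp add: l algebra_simps)
qed

lemma descent_rotate:
  assumes "a < p" "b < p"
  shows "descent (Suc a mod p) (Suc b mod p) - descent a b
         = of_bool (b = p - 1) - of_bool (a = p - 1)"
proof -
  have "Suc x mod p = (if x = p - 1 then 0 else Suc x)" if "x < p" for x
    using that by auto
  then show ?thesis using assms by (auto simp: descent_def)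
qed

lemma winding_rotate:
  "set l \<subseteq> {..<p} \<Longrightarrow> winding (map (\<lambda>t. Suc t mod p) l) = winding l"
proof (induction l rule: winding.induct)
  case (1 a b c l)
  then show ?case
    using descent_rotate[of a p b] descent_rotate[of b p c] descent_rotate[of a p c] by simp
qed simp_all

lemma coboundary_even_cochain:
  assumes "set l \<subseteq> {..<p}" and "even (length l)" and "l \<noteq> []"
  shows "coboundary (even_cochain p) l = odd_cochain (map (\<lambda>t. Suc t mod p) l) - odd_cochain l"
proof -
  obtain a b r where l: "l = a # b # r"
    using assms(2,3) by (cases l rule: remdups_adj.cases) auto
  have "coboundary (\<lambda>x. winding (a # x)) (b # r) = winding (b # r)"
    using coboundary_winding[of "a # b # r"] assms(2) l by simp
  then have *: "coboundary (\<lambda>x. even_cochain p (a # x)) (b # r) = of_bool (a = p - 1) * winding (b # r)"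
    by (simp only: even_cochain_def coboundary_mult list.sel)
  have "winding (Suc b mod p # map (\<lambda>t. Suc t mod p) r) = winding (b # r)"
    using winding_rotate[of "b # r" p] assms(1) l by simp
  then have "odd_cochain (map (\<lambda>t. Suc t mod p) l) - odd_cochain l
      = (descent (Suc a mod p) (Suc b mod p) - descent a b) * winding (b # r)"
    by (simp add: l algebra_simps)
  also have "\<dots> = (of_bool (b = p - 1) - of_bool (a = p - 1)) * winding (b # r)"
    using assms(1) l by (subst descent_rotate) auto
  also have "\<dots> = even_cochain p (b # r) - of_bool (a = p - 1) * winding (b # r)"
    by (simp add: even_cochain_def algebra_simps)
  also have "\<dots> = coboundary (even_cochain p) l"
    unfolding l coboundary_simps(2)[of _ a] * ..
  finally show ?thesis ..
qed

lemma rotate_funpow: "t < p \<Longrightarrow> ((\<lambda>t. Suc t mod p) ^^ j) t = (t + j) mod p"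
  by (induction j) (simp_all add: mod_Suc_eq)

text \<open>Winding is rotation invariant, and exactly one of the \<open>p\<close> rotations moves the first vertex
  to \<open>p - 1\<close>.\<close>

lemma sum_even_cochain:
  assumes "set l \<subseteq> {..<p}" and "l \<noteq> []"
  shows "(\<Sum>j<p. even_cochain p (map ((\<lambda>t. Suc t mod p) ^^ j) l)) = winding l"
proof -
  let ?s = "\<lambda>t. Suc t mod p"
  obtain a r where l: "l = a # r" using assms(2) by (cases l) auto
  have "winding (map (?s ^^ j) l) = winding l" for j
  proof (induction j)
    case (Suc j)
    have "set (map (?s ^^ j) l) \<subseteq> {..<p}"
      using assms l by (fastforce simp: rotate_funpow)
    from winding_rotate[OF this] show ?case using Suc by (simp add: o_def)
  qed simp
  then have "(\<Sum>j<p. even_cochain p (map (?s ^^ j) l))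
      = (\<Sum>j<p. of_bool ((a + j) mod p = p - 1)) * winding l"
    using assms l by (simp add: even_cochain_def rotate_funpow sum_distrib_right)
  also have "(\<Sum>j<p. of_bool ((a + j) mod p = p - 1) :: int) = (\<Sum>j<p. of_bool (j = p - 1 - a))"
  proof (rule sum.cong)
    fix j assume "j \<in> {..<p}"
    \<comment> \<open>\<open>a + j\<close> is less than \<open>2 * p\<close>, so it reduces to itself or to \<open>a + j - p < p - 1\<close>\<close>
    then show "(of_bool ((a + j) mod p = p - 1) :: int) = of_bool (j = p - 1 - a)"
      using assms(1) l by (auto simp: mod_if)
  qed simp
  also have "\<dots> = 1"
    using assms(1) l by (simp add: of_bool_def)
  finally show ?thesis by simp
qed

text \<open>A repeated vertex kills the factor \<open>descent a b + descent b c - descent a c\<close> when it is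
  \<open>a = b\<close> or \<open>b = c\<close>, and every consecutive pair of vertices lies in one such factor.\<close>

lemma winding_degenerate: "odd (length l) \<Longrightarrow> \<not> distinct_adj l \<Longrightarrow> winding l = 0"
  by (induction l rule: winding.induct) (auto simp: descent_def split: if_splits)

lemma odd_cochain_degenerate: "even (length l) \<Longrightarrow> \<not> distinct_adj l \<Longrightarrow> odd_cochain l = 0"
  by (cases l rule: odd_cochain.cases) (auto simp: descent_def winding_degenerate)

text \<open>For a member of a resolution this is the augmentation, in the integers, of the group ring
  coefficient by which the induced map to the standard resolution multiplies the \<open>k\<close>-th
  generator.\<close>

definition degree_mod :: "nat \<Rightarrow> nat \<Rightarrow> (nat list \<Rightarrow>\<^sub>0 int) \<Rightarrow> int" where
  "degree_mod p k y =
     (if odd k then evaluate winding y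
      else \<Sum>j<p. evaluate odd_cochain (push ((\<lambda>t. Suc t mod p) ^^ j) y))"

text \<open>The degree of the first chain is its augmentation, and each step up in dimension preserves
  the degree modulo \<open>p\<close>. From an even dimension to an odd one, the values \<open>e j\<close> and \<open>d j\<close> of the
  two cochains on the rotated chains change by the same amount when \<open>j\<close> grows by one, so their
  sums over all \<open>p\<close> rotations differ by \<open>p\<close> times the constant \<open>e 0 - d 0\<close>. From an odd dimension
  to an even one, the degrees agree by the duality of boundary and coboundary.\<close>

lemma degree_of_resolution:
  assumes res: "resolution_chains p (\<lambda>t. Suc t mod p) n (lists {..<p}) Y" and "k \<in> {1..n}"
  shows "int p dvd degree_mod p k (Y k) - 1"
proof -
  let ?s = "\<lambda>t. Suc t mod p"
  have keys: "Poly_Mapping.keys (Y k) \<subseteq> {l. set l \<subseteq> {..<p} \<and> length l = k}" if "k \<in> {1..n}" for k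
    using res that unfolding resolution_chains_def by fastforce
  have "k \<ge> 1" "k \<le> n" using assms(2) by auto
  then show ?thesis
  proof (induction k rule: dec_induct)
    case base
    have "evaluate winding (Y 1) = evaluate (coboundary (\<lambda>_. 1)) (Y 1)"
    proof (rule evaluate_cong)
      fix c assume "c \<in> Poly_Mapping.keys (Y 1)"
      then obtain t where "c = [t]" using keys[of 1] base by (auto simp: length_Suc_conv)
      then show "winding c = coboundary (\<lambda>_. 1) c" by simp
    qed
    also have "\<dots> = 1"
      using res by (simp add: evaluate_coboundary resolution_chains_def)
    finally show ?case by (simp add: degree_mod_def)
  next
    case (step k)
    then have IH: "int p dvd degree_mod p k (Y k) - 1" by simp
    have bd: "boundary (Y (Suc k)) = differential p ?s k (Y k)"
      using res step by (simp add: resolution_chains_def)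
    have keysk: "Poly_Mapping.keys (Y k) \<subseteq> {l. set l \<subseteq> {..<p} \<and> length l = k}"
      and keysS: "Poly_Mapping.keys (Y (Suc k)) \<subseteq> {l. set l \<subseteq> {..<p} \<and> length l = Suc k}"
      using keys step by auto
    show ?case
    proof (cases "odd k")
      case True
      define d where "d j = evaluate (even_cochain p) (push (?s ^^ j) (Y k))" for j
      define e where "e j = evaluate odd_cochain (push (?s ^^ j) (Y (Suc k)))" for j
      have step1: "e (Suc j) - e j = d (Suc j) - d j" for j
      proof -
        let ?z = "push (?s ^^ j) (Y (Suc k))"
        have keysz: "Poly_Mapping.keys ?z \<subseteq> {l. set l \<subseteq> {..<p} \<and> length l = Suc k}"
          using keys_push[of "?s ^^ j" "Y (Suc k)"] keysS by (fastforce simp: rotate_funpow)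
        have "e (Suc j) - e j = evaluate (\<lambda>l. odd_cochain (map ?s l) - odd_cochain l) ?z"
          by (simp add: e_def evaluate_diff_left evaluate_push o_def)
        also have "\<dots> = evaluate (coboundary (even_cochain p)) ?z"
          by (rule evaluate_cong, subst coboundary_even_cochain) (use keysz True in auto)
        also have "\<dots> = evaluate (even_cochain p) (push (?s ^^ j) (push ?s (Y k) - Y k))"
          using True by (simp add: evaluate_coboundary boundary_push bd differential_def)
        also have "\<dots> = d (Suc j) - d j"
          by (simp add: d_def push_push del: funpow.simps flip: funpow_Suc_right)
        finally show ?thesis .
      qed
      have ej: "e j = d j + (e 0 - d 0)" for j
      proof (induction j)
        case (Suc j)
        then show ?case using step1[of j] by linarith
      qed simp
      have "(\<Sum>j<p. e j) = (\<Sum>j<p. d j + (e 0 - d 0))" by (rule sum.cong[OF refl ej])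
      then have "(\<Sum>j<p. e j) = (\<Sum>j<p. d j) + int p * (e 0 - d 0)"
        by (simp add: sum.distrib)
      moreover have "(\<Sum>j<p. d j) = evaluate winding (Y k)"
      proof -
        have "(\<Sum>j<p. d j) = evaluate (\<lambda>l. \<Sum>j<p. even_cochain p (map (?s ^^ j) l)) (Y k)"
          by (simp add: d_def evaluate_push evaluate_sum_left)
        also have "\<dots> = evaluate winding (Y k)"
          by (rule evaluate_cong, rule sum_even_cochain) (use keysk step in auto)
        finally show ?thesis .
      qed
      ultimately have eq: "degree_mod p (Suc k) (Y (Suc k)) - 1
          = (degree_mod p k (Y k) - 1) + int p * (e 0 - d 0)"
        using True by (simp add: degree_mod_def e_def)
      show ?thesis unfolding eq by (intro dvd_add IH dvd_triv_left)
    next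
      case False
      have "evaluate winding (Y (Suc k)) = evaluate (coboundary odd_cochain) (Y (Suc k))"
      \<comment> \<open>\<open>coboundary_odd_cochain\<close> applies to lists of at least three vertices\<close>
      proof (rule evaluate_cong)
        fix l assume "l \<in> Poly_Mapping.keys (Y (Suc k))"
        then have "length l = Suc k" using keysS by auto
        moreover have "k \<ge> 2" using False step by (cases "k = 1") auto
        ultimately show "winding l = coboundary odd_cochain l"
          using False by (simp add: coboundary_odd_cochain)
      qed
      also have "\<dots> = degree_mod p k (Y k)"
        using False by (simp add: evaluate_coboundary bd differential_def evaluate_sum degree_mod_def)
      finally show ?thesis using IH False by (simp add: degree_mod_def)
    qed
  qed
qed

text \<open>On simplices with two equal consecutive vertices all these cochains vanish, so the last
  chain of a resolution, having a degree prime to \<open>p\<close>, must contain another simplex.\<close>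

lemma resolution_nondegenerate:
  assumes res: "resolution_chains p (\<lambda>t. Suc t mod p) n (lists {..<p}) Y" and "p \<ge> 2" "n \<ge> 1"
  shows "\<exists>l \<in> Poly_Mapping.keys (Y n). distinct_adj l"
proof (rule ccontr)
  let ?s = "\<lambda>t. Suc t mod p"
  assume "\<not> ?thesis"
  moreover have "Poly_Mapping.keys (Y n) \<subseteq> {l. length l = n}"
    using res \<open>n \<ge> 1\<close> unfolding resolution_chains_def by fastforce
  ultimately have deg: "\<not> distinct_adj l \<and> length l = n" if "l \<in> Poly_Mapping.keys (Y n)" for l
    using that by auto
  have zero: "evaluate a (Y n) = 0" if "\<And>l. l \<in> Poly_Mapping.keys (Y n) \<Longrightarrow> a l = 0" for a
    using that by (simp add: evaluate_def)
  have "degree_mod p n (Y n) = 0"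
  proof (cases "odd n")
    case True
    then show ?thesis by (simp add: degree_mod_def) (rule zero, use deg winding_degenerate in auto)
  next
    case False
    have "evaluate odd_cochain (push (?s ^^ j) (Y n)) = 0" for j
      unfolding evaluate_push
      by (rule zero, rule odd_cochain_degenerate) (use deg False distinct_adj_mapD in auto)
    then show ?thesis using False by (simp add: degree_mod_def)
  qed
  then have "int p dvd 1"
    using degree_of_resolution[OF res, of n] \<open>n \<ge> 1\<close> by simp
  then show False using \<open>p \<ge> 2\<close> by simp
qed

section \<open>A Dold-type obstruction for twice subdivided joins\<close>

text \<open>A nonzero sign vector is represented by the set of its pairs of a coordinate and a sign,
  that is by a nonempty single-valued relation. In this form it is a chain of the poset
  \<open>{1..n} \<times> E\<close> ordered by the first component with distinct elements of equal first component
  incomparable, and \<open>\<subseteq>\<close> is the order of the subdivision.\<close>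

definition sign_vector_chains :: "nat \<Rightarrow> 'a set \<Rightarrow> (nat \<times> 'a) set set set" where
  "sign_vector_chains n E = {\<sigma>. \<sigma> \<noteq> {} \<and>
     (\<forall>r \<in> \<sigma>. r \<noteq> {} \<and> single_valued r \<and> r \<subseteq> {1..n} \<times> E) \<and> (\<forall>r \<in> \<sigma>. \<forall>t \<in> \<sigma>. r \<subseteq> t \<or> t \<subseteq> r)}"

text \<open>The pair \<open>(F, L)\<close> is a monotone map to the join of \<open>n - 1\<close> copies of \<open>\<int> / p\<close>, a complex of
  dimension \<open>n - 2\<close>, and \<open>F\<close> is equivariant. The resolution in the join of \<open>n\<close> copies of \<open>E\<close>,
  subdivided twice, would be mapped by \<open>F\<close> to a resolution whose last chain consists of degenerate
  simplices: among \<open>n\<close> nested elements two neighbours have the same level by the pigeonhole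
  principle, and then the same sign.\<close>

theorem no_equivariant_labelling:
  fixes F L :: "(nat \<times> 'a) set set \<Rightarrow> nat"
  assumes "p \<ge> 2" "n \<ge> 1"
    and E: "e \<in> E" "\<And>a. a \<in> E \<Longrightarrow> w a \<in> E" and order: "\<And>a. a \<in> E \<Longrightarrow> (w ^^ p) a = a"
    and F: "\<And>\<sigma>. \<sigma> \<in> sign_vector_chains n E \<Longrightarrow> F \<sigma> < p"
    and equi: "\<And>\<sigma>. \<sigma> \<in> sign_vector_chains n E \<Longrightarrow>
        F (image (image (map_prod id w)) \<sigma>) = Suc (F \<sigma>) mod p"
    and L: "\<And>\<sigma>. \<sigma> \<in> sign_vector_chains n E \<Longrightarrow> L \<sigma> \<in> {1..<n}"
    and mono: "\<And>\<sigma> \<tau>. \<lbrakk>\<sigma> \<in> sign_vector_chains n E; \<tau> \<in> sign_vector_chains n E; \<sigma> \<subseteq> \<tau>\<rbrakk>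
        \<Longrightarrow> L \<sigma> \<le> L \<tau> \<and> (L \<sigma> = L \<tau> \<longrightarrow> F \<sigma> = F \<tau>)"
  shows False
proof -
  let ?s = "map_prod id w" and ?A = "sign_vector_chains n E"
  define L0 where "L0 = {l. sorted_wrt (\<lambda>x y. fst y < fst x) l \<and> set l \<subseteq> {1..n} \<times> E}"
  define L1 where "L1 = {c. sorted_wrt (\<supseteq>) c \<and> (\<exists>l\<in>L0. \<forall>t\<in>set c. t \<noteq> {} \<and> t \<subseteq> set l)}"
  define L2 where "L2 = {d. sorted_wrt (\<supseteq>) d \<and> (\<exists>c\<in>L1. \<forall>\<sigma>\<in>set d. \<sigma> \<noteq> {} \<and> \<sigma> \<subseteq> set c)}"
  obtain X where "resolution_chains p ?s n L0 X"
    using resolution_chains_join[OF E order] unfolding L0_def by blast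
  from resolution_chains_subdivide[OF this \<open>n \<ge> 1\<close>]
  obtain X' where "resolution_chains p (image ?s) n L1 X'"
    unfolding L1_def by blast
  from resolution_chains_subdivide[OF this \<open>n \<ge> 1\<close>]
  obtain X'' where X'': "resolution_chains p (image (image ?s)) n L2 X''"
    unfolding L2_def by blast
  have sv: "single_valued (set l)" if "sorted_wrt (\<lambda>x y. fst y < fst x) l" for l :: "(nat \<times> 'a) list"
    using that by (induction l) (fastforce simp: single_valued_def)+
  have tot: "r \<subseteq> t \<or> t \<subseteq> r" if "sorted_wrt (\<supseteq>) c" "r \<in> set c" "t \<in> set c" for c :: "(nat \<times> 'a) set list" and r t
    using that by (induction c) auto
  have A: "\<sigma> \<in> ?A" if in_d: "d \<in> L2" "\<sigma> \<in> set d" for d \<sigma>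
  proof -
    obtain c where c: "c \<in> L1" "\<sigma> \<noteq> {}" "\<sigma> \<subseteq> set c"
      using in_d unfolding L2_def by blast
    from c(1) obtain l where l: "l \<in> L0" "\<forall>t\<in>set c. t \<noteq> {} \<and> t \<subseteq> set l"
      unfolding L1_def by blast
    have "single_valued (set l)" "set l \<subseteq> {1..n} \<times> E" using l(1) sv unfolding L0_def by auto
    then have "r \<noteq> {} \<and> single_valued r \<and> r \<subseteq> {1..n} \<times> E" if "r \<in> \<sigma>" for r
    proof -
      have "r \<noteq> {}" "r \<subseteq> set l" using that c(3) l(2) by auto
      with \<open>single_valued (set l)\<close> \<open>set l \<subseteq> {1..n} \<times> E\<close> show ?thesis
        using single_valued_subset[of r "set l"] by simp
    qed
    moreover have "r \<subseteq> t \<or> t \<subseteq> r" if "r \<in> \<sigma>" "t \<in> \<sigma>" for r t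
      using that c tot[of c r t] unfolding L1_def by blast
    ultimately show ?thesis using c(2) unfolding sign_vector_chains_def by blast
  qed
  have inv: "image (image ?s) \<sigma> \<in> ?A" if "\<sigma> \<in> ?A" for \<sigma>
  proof -
    have "?s ` r \<noteq> {} \<and> single_valued (?s ` r) \<and> ?s ` r \<subseteq> {1..n} \<times> E" if "r \<in> \<sigma>" for r
    proof -
      have r: "r \<noteq> {}" "single_valued r" "r \<subseteq> {1..n} \<times> E"
        using that \<open>\<sigma> \<in> ?A\<close> unfolding sign_vector_chains_def by auto
      have "single_valued (?s ` r)" using r(2) unfolding single_valued_def by fastforce
      moreover have "?s ` r \<subseteq> {1..n} \<times> E" using r(3) E(2) by auto
      ultimately show ?thesis using r(1) by simp
    qed
    moreover have "?s ` r \<subseteq> ?s ` t \<or> ?s ` t \<subseteq> ?s ` r" if "r \<in> \<sigma>" "t \<in> \<sigma>" for r t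
    proof -
      have "r \<subseteq> t \<or> t \<subseteq> r" using that \<open>\<sigma> \<in> ?A\<close> unfolding sign_vector_chains_def by blast
      then show ?thesis by (meson image_mono)
    qed
    moreover have "\<sigma> \<noteq> {}" using that unfolding sign_vector_chains_def by blast
    ultimately show ?thesis unfolding sign_vector_chains_def by simp
  qed
  have "resolution_chains p (\<lambda>t. Suc t mod p) n (map F ` L2) (\<lambda>k. push F (X'' k))"
  proof (rule resolution_chains_push[OF X''])
    show "L2 \<subseteq> lists ?A" using A by auto
  qed (fact inv, fact equi)
  moreover have "map F ` L2 \<subseteq> lists {..<p}" using A F by fastforce
  ultimately have "resolution_chains p (\<lambda>t. Suc t mod p) n (lists {..<p}) (\<lambda>k. push F (X'' k))"
    by (rule resolution_chains_mono)
  from resolution_nondegenerate[OF this \<open>p \<ge> 2\<close> \<open>n \<ge> 1\<close>]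
  obtain l where "l \<in> Poly_Mapping.keys (push F (X'' n))" "distinct_adj l" by blast
  then obtain d where d: "d \<in> Poly_Mapping.keys (X'' n)" "distinct_adj (map F d)"
    using keys_push[of F "X'' n"] by auto
  have "Poly_Mapping.keys (X'' n) \<subseteq> {l \<in> L2. length l = n}"
    using X'' \<open>n \<ge> 1\<close> unfolding resolution_chains_def by simp
  then have "d \<in> L2" "length d = n" using d(1) by auto
  \<comment> \<open>without equal neighbouring signs, the levels along a nested list would strictly decrease\<close>
  have "sorted_wrt (>) (map L d)"
    if "sorted_wrt (\<supseteq>) d" "set d \<subseteq> ?A" "distinct_adj (map F d)" for d
    using that
  proof (induction d rule: remdups_adj.induct)
    case (3 x y xs)
    then have IH: "sorted_wrt (>) (map L (y # xs))" by (cases "x = y") simp_all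
    have "y \<in> ?A" "x \<in> ?A" "y \<subseteq> x" "F y \<noteq> F x" using "3.prems" by auto
    then have "L y < L x" using mono[of y x] by linarith
    then show ?case using IH by (auto intro: less_trans)
  qed simp_all
  moreover have "sorted_wrt (\<supseteq>) d" "set d \<subseteq> ?A" using \<open>d \<in> L2\<close> A by (auto simp: L2_def)
  ultimately have "sorted_wrt (>) (map L d)" using d(2) by simp
  moreover have "distinct xs" if "sorted_wrt (>) xs" for xs :: "nat list"
    using that by (induction xs) auto
  ultimately have "distinct (map L d)" by simp
  then have "card (L ` set d) = n" using \<open>length d = n\<close> distinct_card[of "map L d"] by simp
  moreover have "card (L ` set d) \<le> card {1..<n}"
  proof (rule card_mono)
    show "L ` set d \<subseteq> {1..<n}" by (rule image_subsetI) (rule L[OF A[OF \<open>d \<in> L2\<close>]])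
  qed simp
  ultimately have "n \<le> card {1..<n}" by simp
  then show False using \<open>n \<ge> 1\<close> by simp
qed

section \<open>Coordinates on free cyclic actions\<close>

text \<open>As \<open>p\<close> is prime, no power \<open>u\<^sup>i\<close> with \<open>0 < i < p\<close> fixes a point of \<open>T\<close>, since \<open>u\<close> would be a
  power of it there. So an orbit has exactly \<open>p\<close> points, and a representative of each orbit serves
  as origin of the coordinate.\<close>

lemma free_action_coordinate:
  fixes u :: "'x \<Rightarrow> 'x"
  assumes "prime p" and inv: "\<And>x. x \<in> T \<Longrightarrow> u x \<in> T"
    and period: "\<And>x. x \<in> T \<Longrightarrow> (u ^^ p) x = x" and free: "\<And>x. x \<in> T \<Longrightarrow> u x \<noteq> x"
  shows "\<exists>F. \<forall>x \<in> T. F x < p \<and> F (u x) = Suc (F x) mod p"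
proof -
  have "p > 0" using \<open>prime p\<close> prime_gt_0_nat by blast
  have inv': "(u ^^ j) x \<in> T" if "x \<in> T" for j x
    using that by (induction j) (auto intro: inv)
  have mult: "(u ^^ (p * j)) x = x" if "x \<in> T" for j x
    by (induction j) (simp_all add: funpow_add period[OF that])
  have pow_mod: "(u ^^ (j mod p)) x = (u ^^ j) x" if "x \<in> T" for j x
  proof -
    have "(u ^^ j) x = (u ^^ (j mod p + p * (j div p))) x" by simp
    also have "\<dots> = (u ^^ (j mod p)) x" by (simp only: funpow_add o_def mult[OF that])
    finally show ?thesis ..
  qed
  have free': "\<not> i < j" if "x \<in> T" "(u ^^ i) x = (u ^^ j) x" "j < p" for i j x
  proof
    assume "i < j"
    let ?y = "(u ^^ i) x" and ?d = "j - i"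
    have y: "?y \<in> T" using inv' that by blast
    have fixd: "(u ^^ ?d) ?y = ?y"
      using that \<open>i < j\<close> by (metis comp_apply funpow_add le_add_diff_inverse2 less_imp_le_nat)
    have fixm: "(u ^^ (?d * k)) ?y = ?y" for k
      by (induction k) (simp_all add: funpow_add fixd)
    have "coprime ?d p"
      using \<open>prime p\<close> \<open>i < j\<close> \<open>j < p\<close>
      by (metis coprime_commute diff_less_mono2 leD less_imp_diff_less nat_dvd_not_less prime_imp_coprime zero_less_diff)
    \<comment> \<open>some multiple of \<open>?d\<close> is \<open>1\<close> modulo \<open>p\<close>, so \<open>u\<close> itself fixes \<open>?y\<close>\<close>
    then obtain a b where "?d * a = p * b + 1"
      using bezout_nat[of ?d p] \<open>i < j\<close> by auto
    then have "u ?y = ?y" using fixm[of a] mult[OF y, of b] by simp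
    then show False using free y by blast
  qed
  define orbit where "orbit x = {(u ^^ j) x |j. True}" for x
  define rep where "rep x = (SOME y. y \<in> orbit x)" for x
  have shift: "(u ^^ j) (u x) = (u ^^ Suc j) x" for j x by (simp add: funpow_swap1)
  have orbit_u: "orbit (u x) = orbit x" if "x \<in> T" for x
  proof
    show "orbit (u x) \<subseteq> orbit x" unfolding orbit_def shift by blast
    have "(u ^^ j) x = (u ^^ (j + (p - 1))) (u x)" for j
    proof -
      have "(u ^^ (j + (p - 1))) (u x) = (u ^^ (j + p)) x"
        using \<open>p > 0\<close> by (simp only: shift) simp
      then show ?thesis by (simp add: funpow_add period[OF that])
    qed
    then show "orbit x \<subseteq> orbit (u x)" unfolding orbit_def by blast
  qed
  have reach: "\<exists>k<p. (u ^^ k) (rep x) = x" if "x \<in> T" for x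
  proof -
    have "x \<in> orbit x" unfolding orbit_def by (auto intro: exI[of _ 0])
    then have "rep x \<in> orbit x" unfolding rep_def by (rule someI)
    then obtain j where j: "rep x = (u ^^ j) x" unfolding orbit_def by blast
    have "(u ^^ (j * (p - 1))) (rep x) = (u ^^ (j * (p - 1) + j)) x"
      by (simp add: j funpow_add)
    also have "j * (p - 1) + j = p * j" using \<open>p > 0\<close> by (simp add: algebra_simps)
    finally have "(u ^^ (j * (p - 1))) (rep x) = x" using mult that by simp
    then have "(u ^^ (j * (p - 1) mod p)) (rep x) = x"
      using pow_mod inv'[OF that] j by simp
    then show ?thesis using \<open>p > 0\<close> by (intro exI[of _ "j * (p - 1) mod p"]) simp
  qed
  have rep_T: "rep x \<in> T" if "x \<in> T" for x
  proof -
    have "x \<in> orbit x" unfolding orbit_def by (auto intro: exI[of _ 0])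
    then have "rep x \<in> orbit x" unfolding rep_def by (rule someI)
    then show ?thesis unfolding orbit_def using inv'[OF that] by auto
  qed
  define F where "F x = (SOME k. k < p \<and> (u ^^ k) (rep x) = x)" for x
  have F: "F x < p \<and> (u ^^ F x) (rep x) = x" if "x \<in> T" for x
    unfolding F_def using someI_ex[of "\<lambda>k. k < p \<and> (u ^^ k) (rep x) = x"] reach[OF that] by blast
  have "F (u x) = Suc (F x) mod p" if "x \<in> T" for x
  proof -
    have rep: "rep (u x) = rep x" using orbit_u[OF that] by (simp add: rep_def)
    have "(u ^^ F (u x)) (rep x) = u x" using F[OF inv[OF that]] rep by simp
    also have "\<dots> = (u ^^ (Suc (F x) mod p)) (rep x)"
      using pow_mod[OF rep_T[OF that]] F[OF that] by simp
    finally show ?thesis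
      using free'[OF rep_T[OF that]] F[OF inv[OF that]] \<open>p > 0\<close>
      by (metis linorder_neqE_nat mod_less_divisor)
  qed
  then show ?thesis using F by blast
qed

section \<open>Balanced subsets of a set of labels\<close>

text \<open>A label is a pair of a sign in \<open>C\<close> and a number. A set of labels is balanced if the numbers
  of labels of any two signs differ by at most one.\<close>

definition min_count :: "'a set \<Rightarrow> ('a \<times> nat) set \<Rightarrow> nat" where
  "min_count C \<tau> = Min ((\<lambda>e. card (\<tau> `` {e})) ` C)"

definition excess :: "'a set \<Rightarrow> ('a \<times> nat) set \<Rightarrow> 'a set" where
  "excess C \<tau> = {e \<in> C. min_count C \<tau> < card (\<tau> `` {e})}"

text \<open>The largest size of a balanced subset: if \<open>h\<close> is the smallest number of labels of a sign,
  such a subset has \<open>h\<close> labels of each sign and one more label of each sign that has more than \<open>h\<close>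
  labels.\<close>

definition balanced_size :: "'a set \<Rightarrow> ('a \<times> nat) set \<Rightarrow> nat" where
  "balanced_size C \<tau> = card C * min_count C \<tau> + card (excess C \<tau>)"

lemma finite_fibre: "finite \<tau> \<Longrightarrow> finite (\<tau> `` {e})"
  by (simp add: finite_Image)

lemma min_count_le: "finite C \<Longrightarrow> e \<in> C \<Longrightarrow> min_count C \<tau> \<le> card (\<tau> `` {e})"
  by (simp add: min_count_def)

lemma card_excess_less:
  assumes "finite C" "C \<noteq> {}"
  shows "excess C \<tau> \<subset> C" and "card (excess C \<tau>) < card C"
proof -
  have "min_count C \<tau> \<in> (\<lambda>e. card (\<tau> `` {e})) ` C"
    unfolding min_count_def using assms by (intro Min_in) auto
  then show "excess C \<tau> \<subset> C" unfolding excess_def by auto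
  then show "card (excess C \<tau>) < card C" using assms by (simp add: psubset_card_mono)
qed

text \<open>Since not all signs are in excess, \<open>balanced_size C \<tau> div card C\<close> is the smallest count \<open>h\<close>.
  A larger set has a larger \<open>h\<close>, or the same \<open>h\<close> and at least the same signs in excess.\<close>

lemma balanced_size_mono:
  assumes C: "finite C" "C \<noteq> {}" and "finite \<tau>'" "\<tau> \<subseteq> \<tau>'"
  shows "balanced_size C \<tau> \<le> balanced_size C \<tau>'"
    and "balanced_size C \<tau> = balanced_size C \<tau>' \<Longrightarrow>
      min_count C \<tau> = min_count C \<tau>' \<and> excess C \<tau> = excess C \<tau>'"
proof -
  have card: "card (\<tau> `` {e}) \<le> card (\<tau>' `` {e})" for e
    using assms by (intro card_mono finite_fibre) auto
  have "min_count C \<tau>' \<in> (\<lambda>e. card (\<tau>' `` {e})) ` C"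
    unfolding min_count_def using C by (intro Min_in) auto
  then obtain e where e: "e \<in> C" "min_count C \<tau>' = card (\<tau>' `` {e})" by auto
  then have le: "min_count C \<tau> \<le> min_count C \<tau>'"
    using card[of e] min_count_le[OF C(1) e(1), of \<tau>] by simp
  consider "min_count C \<tau> < min_count C \<tau>'" | "min_count C \<tau> = min_count C \<tau>'" using le by linarith
  then have "balanced_size C \<tau> < balanced_size C \<tau>' \<or>
    (min_count C \<tau> = min_count C \<tau>' \<and> excess C \<tau> \<subseteq> excess C \<tau>')"
  proof cases
    case 1
    have "balanced_size C \<tau> < card C * Suc (min_count C \<tau>)"
      using card_excess_less(2)[OF C] by (simp add: balanced_size_def)
    also have "\<dots> \<le> card C * min_count C \<tau>'" using 1 by (intro mult_le_mono) auto
    finally show ?thesis by (simp add: balanced_size_def)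
  next
    case 2
    then show ?thesis using card unfolding excess_def by (auto intro: less_le_trans)
  qed
  moreover have "finite (excess C \<tau>')" using C by (simp add: excess_def)
  ultimately show "balanced_size C \<tau> \<le> balanced_size C \<tau>'"
    and "balanced_size C \<tau> = balanced_size C \<tau>' \<Longrightarrow>
      min_count C \<tau> = min_count C \<tau>' \<and> excess C \<tau> = excess C \<tau>'"
    by (auto simp: balanced_size_def card_mono card_subset_eq)
qed

text \<open>Without excess all signs have the same number of labels, and this number is the same for
  both sets.\<close>

lemma balanced_size_eq_no_excess:
  assumes C: "finite C" "C \<noteq> {}" and \<tau>: "finite \<tau>'" "\<tau> \<subseteq> \<tau>'" "\<tau>' \<subseteq> C \<times> UNIV"
    and eq: "balanced_size C \<tau> = balanced_size C \<tau>'" "excess C \<tau> = {}"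
  shows "\<tau> = \<tau>'"
proof -
  have mc: "min_count C \<tau> = min_count C \<tau>'" and ex: "excess C \<tau>' = {}"
    using balanced_size_mono(2)[OF C \<tau>(1,2) eq(1)] eq(2) by auto
  have "\<tau> `` {e} = \<tau>' `` {e}" if "e \<in> C" for e
  proof (rule card_subset_eq)
    have "card (\<rho> `` {e}) = min_count C \<rho>" if "excess C \<rho> = {}" for \<rho>
      using that min_count_le[OF C(1) \<open>e \<in> C\<close>, of \<rho>] \<open>e \<in> C\<close> unfolding excess_def
      by (auto simp: not_less dest: antisym)
    then show "card (\<tau> `` {e}) = card (\<tau>' `` {e})" using mc ex eq(2) by simp
  qed (use \<tau> finite_fibre in auto)
  then show ?thesis using \<tau> by blast
qed

lemma balanced_size_pos:
  assumes C: "finite C" and \<tau>: "finite \<tau>" "\<tau> \<subseteq> C \<times> UNIV" "\<tau> \<noteq> {}"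
  shows "balanced_size C \<tau> > 0"
proof (cases "min_count C \<tau>")
  case 0
  obtain e j where ej: "(e, j) \<in> \<tau>" "e \<in> C" using \<tau> by auto
  then have "card (\<tau> `` {e}) > 0" using finite_fibre[OF \<tau>(1)] by (auto simp: card_gt_0_iff)
  then have "e \<in> excess C \<tau>" using 0 ej by (simp add: excess_def)
  then have "card (excess C \<tau>) > 0" using C by (auto simp: excess_def card_gt_0_iff)
  then show ?thesis by (simp add: balanced_size_def)
next
  case (Suc h)
  have "card C > 0" using C \<tau> by (auto simp: card_gt_0_iff)
  then show ?thesis using Suc by (simp add: balanced_size_def)
qed

text \<open>Every sign receives the quotient \<open>N div card C\<close>, and the signs of a set \<open>S\<close> with
  \<open>N mod card C\<close> elements receive one more label. If the quotient equals the smallest count, then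
  \<open>S\<close> has to be taken among the signs in excess; otherwise every sign has enough labels.\<close>

lemma ex_balanced_subset:
  assumes C: "finite C" "C \<noteq> {}" and \<tau>: "finite \<tau>" "N \<le> balanced_size C \<tau>"
  shows "\<exists>B \<subseteq> \<tau>. card B = N \<and> (\<forall>e \<in> C. N div card C \<le> card (B `` {e}) \<and>
           card (B `` {e}) \<le> N div card C + of_bool (N mod card C \<noteq> 0))"
proof -
  let ?p = "card C" and ?h = "min_count C \<tau>"
  let ?q = "N div ?p" and ?r = "N mod ?p"
  have p: "?p > 0" using C by (simp add: card_gt_0_iff)
  have "N < ?p * Suc ?h" using \<tau>(2) card_excess_less(2)[OF C, of \<tau>] by (simp add: balanced_size_def)
  then have qh: "?q \<le> ?h" using p by (metis div_less_iff_less_mult less_Suc_eq_le mult.commute)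
  have "\<exists>S \<subseteq> C. card S = ?r \<and> (\<forall>e \<in> S. Suc ?q \<le> card (\<tau> `` {e}))"
  proof (cases "?q = ?h")
    case True
    have "?p * ?q + ?r = N" by simp
    then have "?r \<le> card (excess C \<tau>)"
      using \<tau>(2) True by (metis add_le_cancel_left balanced_size_def)
    then obtain S where "S \<subseteq> excess C \<tau>" "card S = ?r" by (meson obtain_subset_with_card_n)
    then show ?thesis using True by (auto simp: excess_def intro!: exI[of _ S])
  next
    case False
    have "?r \<le> card C" using p by (simp add: less_imp_le)
    then obtain S where "S \<subseteq> C" "card S = ?r" by (meson obtain_subset_with_card_n)
    moreover have "Suc ?q \<le> card (\<tau> `` {e})" if "e \<in> C" for e
      using min_count_le[OF C(1) that, of \<tau>] False qh by linarith
    ultimately show ?thesis by blast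
  qed
  then obtain S where S: "S \<subseteq> C" "card S = ?r" "\<And>e. e \<in> S \<Longrightarrow> Suc ?q \<le> card (\<tau> `` {e})" by blast
  have "\<exists>b. b \<subseteq> \<tau> `` {e} \<and> card b = ?q + of_bool (e \<in> S)" if "e \<in> C" for e
  proof -
    have "?q + of_bool (e \<in> S) \<le> card (\<tau> `` {e})"
      using S(3)[of e] min_count_le[OF C(1) that, of \<tau>] qh by (cases "e \<in> S") auto
    then show ?thesis by (meson obtain_subset_with_card_n)
  qed
  then obtain b where b: "\<And>e. e \<in> C \<Longrightarrow> b e \<subseteq> \<tau> `` {e} \<and> card (b e) = ?q + of_bool (e \<in> S)" by metis
  define B where "B = Sigma C b"
  have fib: "B `` {e} = b e" if "e \<in> C" for e using that by (auto simp: B_def)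
  have "finite (b e)" if "e \<in> C" for e
    using b[OF that] finite_fibre[OF \<tau>(1)] finite_subset by blast
  then have "card B = (\<Sum>e\<in>C. card (b e))" unfolding B_def using C(1) by simp
  also have "\<dots> = (\<Sum>e\<in>C. ?q + of_bool (e \<in> S))" using b by simp
  also have "\<dots> = ?p * ?q + card (C \<inter> S)" using C(1) by (simp add: sum.distrib)
  also have "\<dots> = N" using S by (simp add: Int_absorb1)
  finally have "card B = N" .
  moreover have "B \<subseteq> \<tau>" using b by (auto simp: B_def)
  moreover have "?r \<noteq> 0" if "e \<in> S" for e
    using that S(1,2) C(1) by (metis card_0_eq empty_iff finite_subset)
  ultimately show ?thesis using fib b by (intro exI[of _ B]) auto
qed

section \<open>Levels and cores of label sets\<close>

definition high_labels :: "nat \<Rightarrow> ('a \<times> nat) set \<Rightarrow> ('a \<times> nat) set" where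
  "high_labels \<alpha> \<tau> = {x \<in> \<tau>. \<alpha> < snd x}"

text \<open>Along a chain of vectors the low labels have one sign for each second component, so the
  largest label of a purely low set determines a level and a sign. If there is a high label, the
  low ones are ignored. The offset \<open>\<alpha>\<close> then puts the level above all levels of purely low sets.\<close>

definition level :: "'a set \<Rightarrow> nat \<Rightarrow> ('a \<times> nat) set \<Rightarrow> nat" where
  "level C \<alpha> \<tau> = (if high_labels \<alpha> \<tau> = {} then Max (snd ` \<tau>)
     else \<alpha> + balanced_size C (high_labels \<alpha> \<tau>))"

text \<open>A set from which the sign of \<open>\<tau>\<close> is selected equivariantly. The second component \<open>0\<close> only
  serves to turn a set of signs into a set of labels, such that one selection handles all three
  cases.\<close>

definition core :: "'a set \<Rightarrow> nat \<Rightarrow> ('a \<times> nat) set \<Rightarrow> ('a \<times> nat) set" where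
  "core C \<alpha> \<tau> =
    (if high_labels \<alpha> \<tau> = {} then {x \<in> \<tau>. snd x = Max (snd ` \<tau>)}
     else if excess C (high_labels \<alpha> \<tau>) \<noteq> {} then excess C (high_labels \<alpha> \<tau>) \<times> {0}
     else high_labels \<alpha> \<tau>)"

text \<open>Two nested sets of labels with the same level are both purely low with the same largest
  label, or both have the same nonempty set of signs in excess, or both have no excess and the
  same high labels.\<close>

lemma level_mono:
  assumes C: "finite C" "C \<noteq> {}"
    and \<tau>: "finite \<tau>'" "\<tau> \<subseteq> \<tau>'" "\<tau> \<noteq> {}" "\<tau>' \<subseteq> C \<times> UNIV"
    and low: "\<And>e e' j. (e, j) \<in> \<tau>' \<Longrightarrow> (e', j) \<in> \<tau>' \<Longrightarrow> j \<le> \<alpha> \<Longrightarrow> e = e'"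
  shows "level C \<alpha> \<tau> \<le> level C \<alpha> \<tau>'"
    and "level C \<alpha> \<tau> = level C \<alpha> \<tau>' \<Longrightarrow> core C \<alpha> \<tau> = core C \<alpha> \<tau>'"
proof -
  let ?H = "high_labels \<alpha> \<tau>" and ?H' = "high_labels \<alpha> \<tau>'"
  have H: "?H \<subseteq> ?H'" "finite ?H'" "?H' \<subseteq> C \<times> UNIV" using \<tau> by (auto simp: high_labels_def)
  have fin: "finite \<tau>" using \<tau> finite_subset by blast
  have Max_in': "Max (snd ` \<tau>) \<in> snd ` \<tau>" using fin \<tau> by (intro Max_in) auto
  consider (low) "?H' = {}" | (mixed) "?H = {}" "?H' \<noteq> {}" | (high) "?H \<noteq> {}" "?H' \<noteq> {}"
    using H(1) by blast
  then have "level C \<alpha> \<tau> \<le> level C \<alpha> \<tau>' \<and>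
    (level C \<alpha> \<tau> = level C \<alpha> \<tau>' \<longrightarrow> core C \<alpha> \<tau> = core C \<alpha> \<tau>')"
  proof cases
    case low
    then have "?H = {}" using H by blast
    have "Max (snd ` \<tau>) \<le> Max (snd ` \<tau>')" using \<tau> by (intro Max_mono) auto
    moreover have "{x \<in> \<tau>. snd x = Max (snd ` \<tau>)} = {x \<in> \<tau>'. snd x = Max (snd ` \<tau>)}"
    proof -
      obtain x where x: "x \<in> \<tau>" "snd x = Max (snd ` \<tau>)" using Max_in' by auto
      have "y = x" if "y \<in> \<tau>'" "snd y = Max (snd ` \<tau>)" for y
      proof -
        have "snd y \<le> \<alpha>" using that(1) low by (cases y) (auto simp: high_labels_def not_less)
        then show ?thesis
          using assms(7)[of "fst y" "snd y" "fst x"] that x \<tau>(2) by (metis prod.collapse subsetD)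
      qed
      then show ?thesis using x \<tau>(2) by blast
    qed
    then have "core C \<alpha> \<tau> = core C \<alpha> \<tau>'" if "Max (snd ` \<tau>) = Max (snd ` \<tau>')"
      using low \<open>?H = {}\<close> that by (simp add: core_def)
    ultimately show ?thesis using low \<open>?H = {}\<close> by (simp add: level_def)
  next
    case mixed
    have "Max (snd ` \<tau>) \<le> \<alpha>" using Max_in' mixed by (auto simp: high_labels_def not_less)
    moreover have "balanced_size C ?H' > 0" using balanced_size_pos[OF C(1) H(2,3)] mixed by blast
    ultimately show ?thesis using mixed by (simp add: level_def)
  next
    case high
    have "core C \<alpha> \<tau> = core C \<alpha> \<tau>'" if "balanced_size C ?H = balanced_size C ?H'"
      using balanced_size_mono(2)[OF C H(2,1) that] balanced_size_eq_no_excess[OF C H(2,1,3) that] high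
      by (auto simp: core_def)
    then show ?thesis using high balanced_size_mono(1)[OF C H(2,1)] by (auto simp: level_def)
  qed
  then show "level C \<alpha> \<tau> \<le> level C \<alpha> \<tau>'"
    and "level C \<alpha> \<tau> = level C \<alpha> \<tau>' \<Longrightarrow> core C \<alpha> \<tau> = core C \<alpha> \<tau>'" by blast+
qed

lemma core_subset: "\<tau> \<subseteq> C \<times> UNIV \<Longrightarrow> core C \<alpha> \<tau> \<subseteq> C \<times> UNIV"
  by (auto simp: core_def high_labels_def excess_def)

text \<open>The core breaks the symmetry of the signs: some second component occurs in it with some sign
  but not with all signs. Hence a rotation that permutes the signs transitively does not fix it.\<close>

lemma core_partial:
  assumes C: "finite C" "card C \<ge> 2"
    and \<tau>: "finite \<tau>" "\<tau> \<noteq> {}" "\<tau> \<subseteq> C \<times> UNIV"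
    and low: "\<And>e e' j. (e, j) \<in> \<tau> \<Longrightarrow> (e', j) \<in> \<tau> \<Longrightarrow> j \<le> \<alpha> \<Longrightarrow> e = e'"
    and high: "\<And>j. j > \<alpha> \<Longrightarrow> \<exists>e \<in> C. (e, j) \<notin> \<tau>"
  shows "\<exists>e j e'. (e, j) \<in> core C \<alpha> \<tau> \<and> e' \<in> C \<and> (e', j) \<notin> core C \<alpha> \<tau>"
proof -
  have "C \<noteq> {}" using C by auto
  let ?H = "high_labels \<alpha> \<tau>"
  consider (low) "?H = {}" | (excess) "?H \<noteq> {}" "excess C ?H \<noteq> {}"
    | (even) "?H \<noteq> {}" "excess C ?H = {}" by blast
  then show ?thesis
  proof cases
    case low
    have "Max (snd ` \<tau>) \<in> snd ` \<tau>" using \<tau> by (intro Max_in) auto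
    then obtain e j where ej: "(e, j) \<in> \<tau>" "j = Max (snd ` \<tau>)" by auto
    have "j \<le> \<alpha>" using ej low by (auto simp: high_labels_def not_less)
    obtain e' where "e' \<in> C" "e' \<noteq> e"
    proof -
      have "\<not> C \<subseteq> {e}" using C(2) card_mono[of "{e}" C] by fastforce
      then show thesis using that by blast
    qed
    then have "(e', j) \<notin> \<tau>" using assms(6)[OF ej(1) _ \<open>j \<le> \<alpha>\<close>] by blast
    moreover have "core C \<alpha> \<tau> = {x \<in> \<tau>. snd x = j}" using low ej(2) by (simp add: core_def)
    ultimately show ?thesis using ej(1) \<open>e' \<in> C\<close>
      by (intro exI[of _ e] exI[of _ j] exI[of _ e']) simp
  next
    case excess
    then have core: "core C \<alpha> \<tau> = excess C ?H \<times> {0}" by (simp add: core_def)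
    obtain e where "e \<in> excess C ?H" using excess by blast
    moreover obtain e' where "e' \<in> C" "e' \<notin> excess C ?H"
      using card_excess_less(1)[OF C(1) \<open>C \<noteq> {}\<close>, of ?H] by blast
    ultimately show ?thesis unfolding core
      by (intro exI[of _ e] exI[of _ "0::nat"] exI[of _ e']) simp
  next
    case even
    then have core: "core C \<alpha> \<tau> = ?H" by (simp add: core_def)
    obtain e j where ej: "(e, j) \<in> ?H" using even by auto
    then obtain e' where "e' \<in> C" "(e', j) \<notin> \<tau>" using high[of j] by (auto simp: high_labels_def)
    then show ?thesis unfolding core using ej by (auto simp: high_labels_def)
  qed
qed

lemma fibre_map:
  assumes "inj_on w C" "e \<in> C" "\<tau> \<subseteq> C \<times> UNIV"
  shows "(map_prod w id ` \<tau>) `` {w e} = \<tau> `` {e}"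
proof
  show "(map_prod w id ` \<tau>) `` {w e} \<subseteq> \<tau> `` {e}"
  proof
    fix j assume "j \<in> (map_prod w id ` \<tau>) `` {w e}"
    then obtain a where "(a, j) \<in> \<tau>" "w a = w e" by auto
    then show "j \<in> \<tau> `` {e}" using assms by (auto dest: inj_onD)
  qed
qed force

lemma core_map:
  assumes w: "bij_betw w C C" and \<tau>: "\<tau> \<subseteq> C \<times> UNIV"
  shows "core C \<alpha> (map_prod w id ` \<tau>) = map_prod w id ` core C \<alpha> \<tau>"
proof -
  have inj: "inj_on w C" and im: "w ` C = C" using w by (auto simp: bij_betw_def)
  let ?g = "map_prod w id"
  have H: "high_labels \<alpha> (?g ` \<tau>) = ?g ` high_labels \<alpha> \<tau>" by (auto simp: high_labels_def)
  have mc: "min_count C (?g ` \<rho>) = min_count C \<rho>" if "\<rho> \<subseteq> C \<times> UNIV" for \<rho> :: "('a \<times> nat) set"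
  proof -
    have "(\<lambda>e. card ((?g ` \<rho>) `` {e})) ` C = (\<lambda>e. card ((?g ` \<rho>) `` {w e})) ` C"
      using arg_cong[OF im, of "image (\<lambda>e. card ((?g ` \<rho>) `` {e}))"] by (simp add: image_image)
    also have "\<dots> = (\<lambda>e. card (\<rho> `` {e})) ` C" using fibre_map[OF inj _ that] by simp
    finally show ?thesis by (simp add: min_count_def)
  qed
  have ex: "excess C (?g ` \<rho>) = w ` excess C \<rho>" if "\<rho> \<subseteq> C \<times> UNIV" for \<rho> :: "('a \<times> nat) set"
  proof -
    have "excess C (?g ` \<rho>) = {e \<in> w ` C. min_count C \<rho> < card ((?g ` \<rho>) `` {e})}"
      by (simp add: excess_def mc[OF that] im)
    also have "\<dots> = w ` {e \<in> C. min_count C \<rho> < card ((?g ` \<rho>) `` {w e})}" by auto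
    also have "\<dots> = w ` excess C \<rho>" using fibre_map[OF inj _ that] by (auto simp: excess_def)
    finally show ?thesis .
  qed
  have "snd ` ?g ` \<tau> = snd ` \<tau>" by (simp add: image_image)
  moreover have "{x \<in> ?g ` \<tau>. snd x = M} = ?g ` {x \<in> \<tau>. snd x = M}" for M by auto
  moreover have "high_labels \<alpha> \<tau> \<subseteq> C \<times> UNIV" using \<tau> by (auto simp: high_labels_def)
  moreover have "?g ` (S \<times> {0::nat}) = w ` S \<times> {0}" for S by force
  ultimately show ?thesis by (simp add: core_def H ex)
qed

section \<open>Chains of sign vectors\<close>

definition vector_of :: "nat \<Rightarrow> (nat \<times> 'a) set \<Rightarrow> (nat \<Rightarrow> 'a option)" where
  "vector_of n r = (\<lambda>i\<in>{1..n}. if i \<in> Domain r then Some (THE e. (i, e) \<in> r) else None)"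

lemma vector_of_eq_Some_iff:
  assumes "single_valued r" and "i \<in> {1..n}"
  shows "vector_of n r i = Some e \<longleftrightarrow> (i, e) \<in> r"
proof
  have the: "(THE e. (i, e) \<in> r) = e'" if "(i, e') \<in> r" for e'
    using that assms(1) by (blast dest: single_valuedD)
  show "(i, e) \<in> r" if "vector_of n r i = Some e"
  proof -
    have "i \<in> Domain r" "(THE e. (i, e) \<in> r) = e"
      using that assms(2) by (auto simp: vector_of_def split: if_splits)
    then show ?thesis using the by blast
  qed
  show "vector_of n r i = Some e" if "(i, e) \<in> r"
    using that assms(2) the[OF that] by (auto simp: vector_of_def)
qed

lemma vector_of_nonzero:
  assumes "r \<noteq> {}" and sv: "single_valued r" and r: "r \<subseteq> {1..n} \<times> carrier G"
  shows "vector_of n r \<in> nonzero_vectors G n"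
proof -
  have "vector_of n r i \<in> insert None (Some ` carrier G)" if "i \<in> {1..n}" for i
  proof (cases "vector_of n r i")
    case (Some e)
    then have "(i, e) \<in> r" by (simp only: vector_of_eq_Some_iff[OF sv that])
    then show ?thesis using Some r by auto
  qed simp
  then have "vector_of n r \<in> signed_vectors G n"
    by (auto simp: signed_vectors_def PiE_iff vector_of_def)
  moreover obtain i e where ie: "(i, e) \<in> r" using \<open>r \<noteq> {}\<close> by auto
  then have i: "i \<in> {1..n}" using r by auto
  then have "vector_of n r i = Some e" using ie by (simp only: vector_of_eq_Some_iff[OF sv i])
  then have "vector_of n r \<noteq> zero_vector n" using i by (auto simp: zero_vector_def)
  ultimately show ?thesis by (simp add: nonzero_vectors_def)
qed

lemma vector_of_mono:
  assumes "single_valued t" and "r \<subseteq> t"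
  shows "vec_subseteq G n (vector_of n r) (vector_of n t)"
proof -
  note r = vector_of_eq_Some_iff[OF single_valued_subset[OF assms(2,1)]]
    and t = vector_of_eq_Some_iff[OF assms(1)]
  have "sign_class n (vector_of n r) e \<subseteq> sign_class n (vector_of n t) e" for e
    unfolding sign_class_def using assms(2) by (auto simp: r t)
  then show ?thesis by (simp add: vec_subseteq_def)
qed

lemma vector_of_act:
  assumes sv: "single_valued r"
  shows "vector_of n (map_prod id (\<lambda>x. g \<otimes>\<^bsub>G\<^esub> x) ` r) = vec_act G n g (vector_of n r)"
proof
  fix i
  let ?r = "map_prod id (\<lambda>x. g \<otimes>\<^bsub>G\<^esub> x) ` r"
  have sv': "single_valued ?r" using sv unfolding single_valued_def by fastforce
  show "vector_of n ?r i = vec_act G n g (vector_of n r) i"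
  proof (cases "i \<in> {1..n}")
    case i: True
    show ?thesis
    proof (cases "i \<in> Domain r")
      case True
      then obtain e where e: "(i, e) \<in> r" by blast
      then have "(i, g \<otimes>\<^bsub>G\<^esub> e) \<in> ?r" by force
      then have "vector_of n ?r i = Some (g \<otimes>\<^bsub>G\<^esub> e)"
        by (simp only: vector_of_eq_Some_iff[OF sv' i])
      moreover have "vector_of n r i = Some e" using e by (simp only: vector_of_eq_Some_iff[OF sv i])
      ultimately show ?thesis using i by (simp add: vec_act_def)
    next
      case False
      then have "i \<notin> Domain ?r" by auto
      then show ?thesis using False i by (simp add: vector_of_def vec_act_def)
    qed
  qed (auto simp: vector_of_def vec_act_def)
qed

text \<open>On vectors that are comparable, the number of nonzero coordinates determines the order,
  which allows a chain to be sorted by a numerical key.\<close>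

definition support :: "nat \<Rightarrow> (nat \<Rightarrow> 'a option) \<Rightarrow> nat set" where
  "support n X = {i \<in> {1..n}. X i \<noteq> None}"

lemma vec_subseteq_apply:
  assumes "X \<in> signed_vectors G n" "vec_subseteq G n X Y" "i \<in> support n X"
  shows "Y i = X i"
proof -
  have i: "i \<in> {1..n}" "X i \<noteq> None" using assms(3) by (auto simp: support_def)
  have "X i \<in> insert None (Some ` carrier G)"
    using assms(1) i(1) unfolding signed_vectors_def by (rule PiE_mem)
  then obtain e where e: "X i = Some e" "e \<in> carrier G" using i(2) by auto
  then have "i \<in> sign_class n X e" using i by (simp add: sign_class_def)
  then have "i \<in> sign_class n Y e" using assms(2) e(2) unfolding vec_subseteq_def by blast
  then show ?thesis using e by (simp add: sign_class_def)
qed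

lemma card_support_mono:
  assumes "X \<in> signed_vectors G n" "vec_subseteq G n X Y"
  shows "card (support n X) \<le> card (support n Y)"
proof (rule card_mono)
  show "support n X \<subseteq> support n Y"
    using vec_subseteq_apply[OF assms] by (auto simp: support_def)
qed (simp add: support_def)

lemma eq_if_card_support_eq:
  assumes X: "X \<in> signed_vectors G n" and Y: "Y \<in> signed_vectors G n"
    and sub: "vec_subseteq G n X Y" and card: "card (support n X) = card (support n Y)"
  shows "X = Y"
proof -
  have "support n X \<subseteq> support n Y"
    using vec_subseteq_apply[OF X sub] by (auto simp: support_def)
  moreover have "finite (support n Y)" by (simp add: support_def)
  ultimately have eq: "support n X = support n Y" using card card_subset_eq by blast
  show ?thesis
  proof
    fix i
    consider "i \<in> support n X" | "i \<in> {1..n}" "i \<notin> support n X" | "i \<notin> {1..n}" by blast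
    then show "X i = Y i"
    proof cases
      case 1
      then show ?thesis using vec_subseteq_apply[OF X sub] by simp
    next
      case 2
      then have "i \<notin> support n Y" using eq by simp
      then show ?thesis using 2 by (simp add: support_def)
    next
      case 3
      then show ?thesis using X Y by (auto simp: signed_vectors_def PiE_iff extensional_def)
    qed
  qed
qed

definition vector_chain :: "('a, 'b) monoid_scheme \<Rightarrow> nat \<Rightarrow> (nat \<Rightarrow> 'a option) set \<Rightarrow> bool" where
  "vector_chain G n V \<longleftrightarrow> finite V \<and> V \<subseteq> nonzero_vectors G n \<and>
     (\<forall>X \<in> V. \<forall>Y \<in> V. vec_subseteq G n X Y \<or> vec_subseteq G n Y X)"

text \<open>One preimage in \<open>V\<close> is chosen for each element of \<open>B\<close>, and the chosen vectors are sorted by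
  the size of their support.\<close>

lemma enumerate_chain_by_labels:
  assumes V: "vector_chain G n V" and B: "B \<subseteq> f ` V" "card B = k"
  shows "\<exists>Z. (\<forall>i \<in> {1..k}. Z i \<in> V) \<and> (\<forall>i \<in> {1..<k}. vec_subset G n (Z i) (Z (Suc i))) \<and>
             bij_betw (\<lambda>i. f (Z i)) {1..k} B"
proof -
  obtain U where U: "U \<subseteq> V" "inj_on f U" "B = f ` U" using B(1) subset_image_inj[of B f V] by blast
  have sv: "X \<in> signed_vectors G n" if "X \<in> U" for X
    using that U(1) V unfolding vector_chain_def nonzero_vectors_def by blast
  have total: "vec_subseteq G n X Y \<or> vec_subseteq G n Y X" if "X \<in> U" "Y \<in> U" for X Y
    using that U(1) V unfolding vector_chain_def by blast
  let ?size = "\<lambda>X. card (support n X)"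
  have inj: "inj_on ?size U"
  proof (rule inj_onI)
    fix X Y assume XY: "X \<in> U" "Y \<in> U" "?size X = ?size Y"
    from total[OF XY(1,2)] show "X = Y"
    proof
      assume "vec_subseteq G n X Y"
      from eq_if_card_support_eq[OF sv[OF XY(1)] sv[OF XY(2)] this XY(3)] show "X = Y" .
    next
      assume "vec_subseteq G n Y X"
      from eq_if_card_support_eq[OF sv[OF XY(2)] sv[OF XY(1)] this XY(3)[symmetric]] show "X = Y" ..
    qed
  qed
  have "finite U" using U(1) V by (auto simp: vector_chain_def intro: finite_subset)
  have "card U = k" using U(2,3) B(2) by (simp add: card_image)
  define xs where "xs = sorted_list_of_set (?size ` U)"
  have xs: "sorted_wrt (<) xs" "set xs = ?size ` U" "length xs = k" "distinct xs"
    using \<open>finite U\<close> \<open>card U = k\<close> card_image[OF inj] by (simp_all add: xs_def)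
  \<comment> \<open>the index of \<open>Z\<close> starts at \<open>1\<close>, that of the list at \<open>0\<close>\<close>
  define Z where "Z i = the_inv_into U ?size (xs ! (i - 1))" for i
  have nth: "xs ! (i - 1) \<in> ?size ` U" if "i \<in> {1..k}" for i
  proof -
    have "i - 1 < length xs" using that xs(3) by auto
    then show ?thesis using xs(2) nth_mem by blast
  qed
  have ZU: "Z i \<in> U" and size: "?size (Z i) = xs ! (i - 1)" if "i \<in> {1..k}" for i
    unfolding Z_def using the_inv_into_into[OF inj nth[OF that]] f_the_inv_into_f[OF inj nth[OF that]] by auto
  have step: "vec_subset G n (Z i) (Z (Suc i))" if "i \<in> {1..<k}" for i
  proof -
    have i: "i \<in> {1..k}" "Suc i \<in> {1..k}" using that by auto
    have "xs ! (i - 1) < xs ! i" using sorted_wrt_nth_less[OF xs(1), of "i - 1" i] that xs(3) by simp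
    then have lt: "?size (Z i) < ?size (Z (Suc i))" using size i by simp
    then have "\<not> vec_subseteq G n (Z (Suc i)) (Z i)"
      using card_support_mono[OF sv[OF ZU[OF i(2)]], of "Z i"] by linarith
    then show ?thesis using total[OF ZU[OF i(1)] ZU[OF i(2)]] lt by (auto simp: vec_subset_def)
  qed
  have "inj_on Z {1..k}"
  proof (rule inj_onI)
    fix i j assume ij: "i \<in> {1..k}" "j \<in> {1..k}" "Z i = Z j"
    then have "xs ! (i - 1) = xs ! (j - 1)" using size by metis
    then have "i - 1 = j - 1" using ij xs(3) by (subst (asm) nth_eq_iff_index_eq[OF xs(4)]) auto
    then show "i = j" using ij by auto
  qed
  moreover have "Z ` {1..k} = U"
  proof (rule card_subset_eq)
    show "card (Z ` {1..k}) = card U" using card_image[OF \<open>inj_on Z {1..k}\<close>] \<open>card U = k\<close> by simp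
  qed (use ZU \<open>finite U\<close> in auto)
  ultimately have "bij_betw Z {1..k} U" by (simp add: bij_betw_def)
  moreover have "bij_betw f U B" using U by (simp add: bij_betw_def)
  ultimately have "bij_betw (\<lambda>i. f (Z i)) {1..k} B" using bij_betw_trans[of Z "{1..k}" U f B] by (simp add: o_def)
  then show ?thesis using ZU U(1) step by (intro exI[of _ Z]) auto
qed

section \<open>The labelling theorem\<close>

locale signed_labelling = group G for G :: "('a, 'b) monoid_scheme" (structure) +
  fixes m n p \<alpha> :: nat and lam :: "(nat \<Rightarrow> 'a option) \<Rightarrow> 'a \<times> nat"
  assumes cyclic: "cyclic_group G" and order: "order G = p" and prime: "prime p"
    and lam: "lam \<in> nonzero_vectors G n \<rightarrow> carrier G \<times> {1..m}"
    and equivariant: "equivariant G n lam"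
    and low_constant: "\<And>X1 X2. \<lbrakk>X1 \<in> nonzero_vectors G n; X2 \<in> nonzero_vectors G n; vec_subseteq G n X1 X2;
           snd (lam X1) = snd (lam X2); snd (lam X2) \<le> \<alpha>\<rbrakk>
         \<Longrightarrow> fst (lam X1) = fst (lam X2)"
    and high_not_all: "\<And>X :: nat \<Rightarrow> nat \<Rightarrow> 'a option.
           \<lbrakk>\<forall>i \<in> {1..p}. X i \<in> nonzero_vectors G n;
            \<forall>i \<in> {1..<p}. vec_subseteq G n (X i) (X (Suc i));
            \<forall>i \<in> {1..p}. \<forall>j \<in> {1..p}. snd (lam (X i)) = snd (lam (X j));
            \<forall>i \<in> {1..p}. snd (lam (X i)) \<ge> \<alpha> + 1\<rbrakk>
         \<Longrightarrow> card {fst (lam (X i)) | i. i \<in> {1..p}} < p"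
begin

lemma p_ge_2: "p \<ge> 2" using prime prime_ge_2_nat by blast

lemma finite_carrier: "finite (carrier G)" and card_carrier: "card (carrier G) = p"
  using order p_ge_2 card.infinite by (fastforce simp: order_def)+

lemma funpow_mult: "g \<in> carrier G \<Longrightarrow> a \<in> carrier G \<Longrightarrow> ((\<lambda>x. g \<otimes> x) ^^ j) a = g [^] j \<otimes> a"
proof (induction j)
  case (Suc j)
  have "g [^] Suc j = g \<otimes> g [^] j" by (rule nat_pow_Suc2[OF Suc.prems(1)])
  then show ?case using Suc by (simp add: m_assoc del: nat_pow_Suc)
qed simp

text \<open>Multiplication by a generator.\<close>

lemma ex_rotation:
  "\<exists>g \<in> carrier G. \<forall>a \<in> carrier G. ((\<lambda>x. g \<otimes> x) ^^ p) a = a \<and>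
     (\<forall>b \<in> carrier G. \<exists>j. ((\<lambda>x. g \<otimes> x) ^^ j) a = b)"
proof -
  obtain g where g: "g \<in> carrier G" "subgroup_generated G {g} = G"
    using cyclic unfolding cyclic_group_def by blast
  then have "carrier G = generate G {g}"
    using carrier_subgroup_generated[of G "{g}"] by (simp add: Int_absorb1)
  then have gen: "carrier G = {g [^] k | k. k \<in> (UNIV :: nat set)}"
    using generate_pow_on_finite_carrier[OF finite_carrier g(1)] by simp
  have "g [^] p = \<one>" using pow_order_eq_1[OF g(1)] order by simp
  moreover have "\<exists>j. ((\<lambda>x. g \<otimes> x) ^^ j) a = b" if ab: "a \<in> carrier G" "b \<in> carrier G" for a b
  proof -
    have "b \<otimes> inv a \<in> carrier G" using ab by simp
    then obtain j :: nat where j: "b \<otimes> inv a = g [^] j" using gen by blast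
    have "((\<lambda>x. g \<otimes> x) ^^ j) a = b \<otimes> inv a \<otimes> a" using funpow_mult[OF g(1) ab(1)] j by simp
    then show ?thesis using ab by (auto simp: m_assoc)
  qed
  ultimately show ?thesis using g(1) funpow_mult by (intro bexI[of _ g]) auto
qed

lemma labels_subset: "vector_chain G n V \<Longrightarrow> lam ` V \<subseteq> carrier G \<times> {1..m}"
  using lam unfolding vector_chain_def by blast

lemma low_labels_unique:
  assumes V: "vector_chain G n V" and "(e, j) \<in> lam ` V" "(e', j) \<in> lam ` V" "j \<le> \<alpha>"
  shows "e = e'"
proof -
  obtain X Y where XY: "X \<in> V" "Y \<in> V" "lam X = (e, j)" "lam Y = (e', j)"
    using assms(2,3) by (metis imageE)
  have nz: "X \<in> nonzero_vectors G n" "Y \<in> nonzero_vectors G n"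
    using V XY(1,2) unfolding vector_chain_def by auto
  have "vec_subseteq G n X Y \<or> vec_subseteq G n Y X" using V XY(1,2) unfolding vector_chain_def by blast
  then show ?thesis
    using low_constant[OF nz] low_constant[OF nz(2,1)] XY(3,4) \<open>j \<le> \<alpha>\<close> by auto
qed

text \<open>If all signs occurred with \<open>j\<close>, then vectors carrying them could be arranged as a chain of
  \<open>p\<close> vectors that violates \<open>high_not_all\<close>.\<close>

lemma high_labels_partial:
  assumes V: "vector_chain G n V" and "j > \<alpha>"
  shows "\<exists>e \<in> carrier G. (e, j) \<notin> lam ` V"
proof (rule ccontr)
  assume "\<not> ?thesis"
  then have sub: "carrier G \<times> {j} \<subseteq> lam ` V" by auto
  have "card (carrier G \<times> {j}) = p" using card_carrier by (simp add: card_cartesian_product)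
  from enumerate_chain_by_labels[OF V sub this] obtain Z where Z: "\<forall>i \<in> {1..p}. Z i \<in> V"
      "\<forall>i \<in> {1..<p}. vec_subset G n (Z i) (Z (Suc i))"
      and bij: "bij_betw (\<lambda>i. lam (Z i)) {1..p} (carrier G \<times> {j})"
    by blast
  have im: "(\<lambda>i. lam (Z i)) ` {1..p} = carrier G \<times> {j}" using bij by (simp add: bij_betw_def)
  have snd: "snd (lam (Z i)) = j" if "i \<in> {1..p}" for i
  proof -
    have "lam (Z i) \<in> carrier G \<times> {j}" unfolding im[symmetric] using that by (rule imageI)
    then show ?thesis by auto
  qed
  have "card {fst (lam (Z i)) | i. i \<in> {1..p}} < p"
  proof (rule high_not_all)
    show "\<forall>i \<in> {1..p}. Z i \<in> nonzero_vectors G n" using Z(1) V unfolding vector_chain_def by blast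
    show "\<forall>i \<in> {1..<p}. vec_subseteq G n (Z i) (Z (Suc i))" using Z(2) by (simp add: vec_subset_def)
  qed (use snd \<open>j > \<alpha>\<close> in simp_all)
  moreover have "{fst (lam (Z i)) | i. i \<in> {1..p}} = fst ` (carrier G \<times> {j})"
    unfolding im[symmetric] by blast
  ultimately show False using card_carrier by simp
qed

text \<open>If all chains have small balanced size, then the level of the label set and the sign
  selected from its core contradict \<open>no_equivariant_labelling\<close>.\<close>

lemma ex_large_chain:
  assumes "\<alpha> < n"
  shows "\<exists>V. vector_chain G n V \<and> n - \<alpha> \<le> balanced_size (carrier G) (high_labels \<alpha> (lam ` V))"
proof (rule ccontr)
  assume "\<not> ?thesis"
  then have small: "balanced_size (carrier G) (high_labels \<alpha> (lam ` V)) < n - \<alpha>"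
    if "vector_chain G n V" for V using that not_le by blast
  let ?C = "carrier G"
  have C: "finite ?C" "?C \<noteq> {}" using finite_carrier by auto
  obtain g where g: "g \<in> ?C"
    and period: "\<And>a. a \<in> ?C \<Longrightarrow> ((\<lambda>x. g \<otimes> x) ^^ p) a = a"
    and trans: "\<And>a b. a \<in> ?C \<Longrightarrow> b \<in> ?C \<Longrightarrow> \<exists>j. ((\<lambda>x. g \<otimes> x) ^^ j) a = b"
    using ex_rotation by blast
  define w where "w = (\<lambda>x. g \<otimes> x)"
  define u :: "('a \<times> nat) set \<Rightarrow> ('a \<times> nat) set" where "u = image (map_prod w id)"
  \<comment> \<open>\<open>T\<close> consists of the sets of labels that the rotation moves; all its elements have free orbits\<close>
  define T where "T = {K. K \<subseteq> ?C \<times> UNIV \<and> u K \<noteq> K}"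
  have w: "w a \<in> ?C" if "a \<in> ?C" for a using that g by (simp add: w_def)
  have w_period: "(w ^^ p) a = a" if "a \<in> ?C" for a unfolding w_def using period[OF that] .
  have w_pow: "(map_prod w id ^^ j) (a, i) = ((w ^^ j) a, i)" for j a and i :: nat
    by (induction j) simp_all
  have u_pow: "(u ^^ j) K = (map_prod w id ^^ j) ` K" for j K
    unfolding u_def by (simp add: image_funpow)
  have u_period: "(u ^^ p) K = K" if "K \<subseteq> ?C \<times> UNIV" for K
  proof -
    have "(map_prod w id ^^ p) x = x" if "x \<in> K" for x
      using that \<open>K \<subseteq> ?C \<times> UNIV\<close> w_period by (cases x) (auto simp: w_pow)
    then show ?thesis unfolding u_pow by simp
  qed
  have u_sub: "u K \<subseteq> ?C \<times> UNIV" if "K \<subseteq> ?C \<times> UNIV" for K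
    using that w by (auto simp: u_def)
  have u_T: "u K \<in> T" if "K \<in> T" for K
  proof -
    have K: "K \<subseteq> ?C \<times> UNIV" "u K \<noteq> K" using that by (auto simp: T_def)
    have False if "u (u K) = u K"
    proof -
      have "(u ^^ j) (u K) = u K" for j by (induction j) (simp_all add: that)
      moreover have "(u ^^ (p - 1)) (u K) = (u ^^ Suc (p - 1)) K" by (simp only: funpow_Suc_right o_apply)
      ultimately show False using u_period[OF K(1)] K(2) p_ge_2 by simp
    qed
    then show ?thesis using u_sub[OF K(1)] by (auto simp: T_def)
  qed
  \<comment> \<open>a set fixed by the rotation contains, with a label, all labels of the same second component\<close>
  have not_fixed: "K \<in> T" if "K \<subseteq> ?C \<times> UNIV" "(e, j) \<in> K" "e' \<in> ?C" "(e', j) \<notin> K" for K e j e'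
  proof -
    have False if "u K = K"
    proof -
      have "e \<in> ?C" using \<open>K \<subseteq> _\<close> \<open>(e, j) \<in> K\<close> by auto
      then obtain i where i: "(w ^^ i) e = e'" using trans[OF _ \<open>e' \<in> ?C\<close>] unfolding w_def by blast
      have "(u ^^ i) K = K" by (induction i) (simp_all add: that)
      moreover have "(e', j) \<in> (u ^^ i) K"
        unfolding u_pow by (rule image_eqI[OF _ \<open>(e, j) \<in> K\<close>]) (simp add: w_pow i)
      ultimately show False using \<open>(e', j) \<notin> K\<close> by simp
    qed
    then show ?thesis using \<open>K \<subseteq> _\<close> by (auto simp: T_def)
  qed
  have "\<exists>sel. \<forall>K \<in> T. sel K < p \<and> sel (u K) = Suc (sel K) mod p"
  proof (rule free_action_coordinate[OF prime])
    show "u K \<in> T" if "K \<in> T" for K using u_T[OF that] .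
    show "(u ^^ p) K = K" "u K \<noteq> K" if "K \<in> T" for K
      using that u_period unfolding T_def by simp_all
  qed
  then obtain sel where sel: "\<And>K. K \<in> T \<Longrightarrow> sel K < p \<and> sel (u K) = Suc (sel K) mod p"
    by blast
  let ?A = "sign_vector_chains n ?C"
  define V where "V \<sigma> = vector_of n ` \<sigma>" for \<sigma> :: "(nat \<times> 'a) set set"
  have V_chain: "vector_chain G n (V \<sigma>)" and V_ne: "V \<sigma> \<noteq> {}" if "\<sigma> \<in> ?A" for \<sigma>
  proof -
    have r: "r \<noteq> {}" "single_valued r" "r \<subseteq> {1..n} \<times> ?C" if "r \<in> \<sigma>" for r
      using that \<open>\<sigma> \<in> ?A\<close> unfolding sign_vector_chains_def by auto
    have "\<sigma> \<subseteq> Pow ({1..n} \<times> ?C)" using r by auto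
    then have "finite \<sigma>" by (rule finite_subset) (use C(1) in simp)
    moreover have "vector_of n r \<in> nonzero_vectors G n" if "r \<in> \<sigma>" for r
      using vector_of_nonzero r[OF that] by blast
    moreover have "vec_subseteq G n (vector_of n r) (vector_of n t) \<or>
        vec_subseteq G n (vector_of n t) (vector_of n r)" if "r \<in> \<sigma>" "t \<in> \<sigma>" for r t
    proof -
      have "r \<subseteq> t \<or> t \<subseteq> r" using that \<open>\<sigma> \<in> ?A\<close> unfolding sign_vector_chains_def by blast
      then show ?thesis
        using vector_of_mono[OF r(2)[OF that(1)]] vector_of_mono[OF r(2)[OF that(2)]] by blast
    qed
    ultimately show "vector_chain G n (V \<sigma>)" unfolding vector_chain_def V_def by auto
    show "V \<sigma> \<noteq> {}" using that unfolding V_def sign_vector_chains_def by blast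
  qed
  define \<tau> where "\<tau> \<sigma> = lam ` V \<sigma>" for \<sigma>
  have \<tau>: "finite (\<tau> \<sigma>)" "\<tau> \<sigma> \<noteq> {}" "\<tau> \<sigma> \<subseteq> ?C \<times> UNIV" "\<tau> \<sigma> \<subseteq> ?C \<times> {1..m}" if "\<sigma> \<in> ?A" for \<sigma>
    using V_chain[OF that] V_ne[OF that] labels_subset[OF V_chain[OF that]]
    unfolding \<tau>_def vector_chain_def by auto
  have \<tau>_low: "e = e'" if "\<sigma> \<in> ?A" "(e, j) \<in> \<tau> \<sigma>" "(e', j) \<in> \<tau> \<sigma>" "j \<le> \<alpha>" for \<sigma> e e' j
    using low_labels_unique[OF V_chain[OF that(1)]] that(2-4) unfolding \<tau>_def by blast
  have \<tau>_high: "\<exists>e \<in> ?C. (e, j) \<notin> \<tau> \<sigma>" if "\<sigma> \<in> ?A" "j > \<alpha>" for \<sigma> j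
    using high_labels_partial[OF V_chain[OF that(1)] that(2)] unfolding \<tau>_def .
  have core_T: "core ?C \<alpha> (\<tau> \<sigma>) \<in> T" if "\<sigma> \<in> ?A" for \<sigma>
  proof -
    have "\<exists>e j e'. (e, j) \<in> core ?C \<alpha> (\<tau> \<sigma>) \<and> e' \<in> ?C \<and> (e', j) \<notin> core ?C \<alpha> (\<tau> \<sigma>)"
    proof (rule core_partial[OF C(1)])
      show "2 \<le> card ?C" using p_ge_2 card_carrier by simp
    qed (fact \<tau>(1-3)[OF that] \<tau>_low[OF that] \<tau>_high[OF that])+
    then obtain e j e' where "(e, j) \<in> core ?C \<alpha> (\<tau> \<sigma>)" "e' \<in> ?C" "(e', j) \<notin> core ?C \<alpha> (\<tau> \<sigma>)"
      by blast
    then show ?thesis by (rule not_fixed[OF core_subset[OF \<tau>(3)[OF that]]])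
  qed
  define F where "F \<sigma> = sel (core ?C \<alpha> (\<tau> \<sigma>))" for \<sigma>
  define L where "L \<sigma> = level ?C \<alpha> (\<tau> \<sigma>)" for \<sigma>
  show False
  proof (rule no_equivariant_labelling[where p = p and n = n and E = ?C and e = \<one> and w = w
        and F = F and L = L])
    show "p \<ge> 2" by (rule p_ge_2)
    show "n \<ge> 1" using \<open>\<alpha> < n\<close> by simp
    show "\<one> \<in> ?C" by simp
    show "w a \<in> ?C" if "a \<in> ?C" for a using w[OF that] .
    show "(w ^^ p) a = a" if "a \<in> ?C" for a using w_period[OF that] .
    show "F \<sigma> < p" if "\<sigma> \<in> ?A" for \<sigma> using sel[OF core_T[OF that]] unfolding F_def by blast
    show "F (image (image (map_prod id w)) \<sigma>) = Suc (F \<sigma>) mod p" if "\<sigma> \<in> ?A" for \<sigma>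
    proof -
      have "lam (vector_of n (map_prod id w ` r)) = map_prod w id (lam (vector_of n r))" if "r \<in> \<sigma>" for r
      proof -
        have r: "r \<noteq> {}" "single_valued r" "r \<subseteq> {1..n} \<times> ?C"
          using that \<open>\<sigma> \<in> ?A\<close> unfolding sign_vector_chains_def by auto
        have "lam (vec_act G n g (vector_of n r)) = label_act G g (lam (vector_of n r))"
          using equivariant g vector_of_nonzero[OF r] unfolding equivariant_def by blast
        then show ?thesis
          unfolding w_def vector_of_act[OF r(2)] label_act_def by (simp add: map_prod_def split_beta)
      qed
      then have "\<tau> (image (image (map_prod id w)) \<sigma>) = u (\<tau> \<sigma>)"
        unfolding \<tau>_def V_def u_def image_image by (intro image_cong) auto
      moreover have "core ?C \<alpha> (u (\<tau> \<sigma>)) = u (core ?C \<alpha> (\<tau> \<sigma>))"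
      proof -
        have "inj_on w ?C" using g by (auto simp: inj_on_def w_def)
        moreover have "w ` ?C \<subseteq> ?C" using w by blast
        ultimately have "bij_betw w ?C ?C" using C(1) by (simp add: bij_betw_def endo_inj_surj)
        then show ?thesis unfolding u_def using core_map \<tau>(3)[OF that] by blast
      qed
      ultimately show ?thesis using sel[OF core_T[OF that]] by (simp add: F_def)
    qed
    show "L \<sigma> \<in> {1..<n}" if "\<sigma> \<in> ?A" for \<sigma>
    proof (cases "high_labels \<alpha> (\<tau> \<sigma>) = {}")
      case True
      have "Max (snd ` \<tau> \<sigma>) \<in> snd ` \<tau> \<sigma>" using \<tau>(1,2)[OF that] by (intro Max_in) auto
      then obtain e j where ej: "(e, j) \<in> \<tau> \<sigma>" "Max (snd ` \<tau> \<sigma>) = j" by auto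
      then have "j \<ge> 1" using \<tau>(4)[OF that] by auto
      moreover have "j \<le> \<alpha>" using True ej by (auto simp: high_labels_def not_less)
      ultimately show ?thesis using True ej \<open>\<alpha> < n\<close> by (simp add: L_def level_def)
    next
      case False
      have "high_labels \<alpha> (\<tau> \<sigma>) \<subseteq> ?C \<times> UNIV" "finite (high_labels \<alpha> (\<tau> \<sigma>))"
        using \<tau>(1,3)[OF that] by (auto simp: high_labels_def)
      then have "balanced_size ?C (high_labels \<alpha> (\<tau> \<sigma>)) > 0"
        using balanced_size_pos[OF C(1)] False by blast
      then show ?thesis
        using False small[OF V_chain[OF that]] by (simp add: L_def level_def \<tau>_def)
    qed
    show "L \<sigma> \<le> L \<sigma>' \<and> (L \<sigma> = L \<sigma>' \<longrightarrow> F \<sigma> = F \<sigma>')"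
      if "\<sigma> \<in> ?A" "\<sigma>' \<in> ?A" "\<sigma> \<subseteq> \<sigma>'" for \<sigma> \<sigma>'
    proof -
      have sub: "\<tau> \<sigma> \<subseteq> \<tau> \<sigma>'" using that(3) unfolding \<tau>_def V_def by blast
      note mono = level_mono[OF C \<tau>(1)[OF that(2)] sub \<tau>(2)[OF that(1)] \<tau>(3)[OF that(2)]
          \<tau>_low[OF that(2)]]
      show ?thesis unfolding L_def F_def using mono by auto
    qed
  qed
qed

text \<open>For each \<open>j\<close> in \<open>{\<alpha> + 1..m}\<close> at most \<open>p - 1\<close> signs occur with \<open>j\<close> along a chain.\<close>

lemma card_high_labels_le:
  assumes V: "vector_chain G n V" and B: "B \<subseteq> high_labels \<alpha> (lam ` V)" and "\<alpha> \<le> m"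
  shows "card B \<le> (p - 1) * (m - \<alpha>)"
proof -
  define R where "R j = {e. (e, j) \<in> lam ` V}" for j
  have "B \<subseteq> (\<Union>j \<in> {\<alpha><..m}. R j \<times> {j})"
  proof
    fix x assume "x \<in> B"
    then have "x \<in> lam ` V" "\<alpha> < snd x" using B by (auto simp: high_labels_def)
    moreover from this have "snd x \<le> m" using labels_subset[OF V] by auto
    ultimately show "x \<in> (\<Union>j \<in> {\<alpha><..m}. R j \<times> {j})"
      by (intro UN_I[of "snd x"]) (auto simp: R_def mem_Times_iff)
  qed
  moreover have R: "finite (R j) \<and> card (R j) \<le> p - 1" if j: "j \<in> {\<alpha><..m}" for j
  proof -
    have "R j \<subseteq> carrier G" using labels_subset[OF V] unfolding R_def by blast
    moreover obtain e where "e \<in> carrier G" "e \<notin> R j"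
      using high_labels_partial[OF V, of j] j unfolding R_def by auto
    ultimately have "R j \<subset> carrier G" by blast
    then have "card (R j) < p" using psubset_card_mono[OF finite_carrier] card_carrier by simp
    moreover have "finite (R j)" using \<open>R j \<subset> carrier G\<close> finite_carrier by (auto intro: finite_subset)
    ultimately show ?thesis by simp
  qed
  ultimately have "card B \<le> card (\<Union>j \<in> {\<alpha><..m}. R j \<times> {j})" by (intro card_mono) auto
  also have "\<dots> \<le> (\<Sum>j \<in> {\<alpha><..m}. card (R j \<times> {j}))" by (rule card_UN_le) simp
  also have "\<dots> \<le> (\<Sum>j \<in> {\<alpha><..m}. p - 1)"
    by (rule sum_mono) (use R in \<open>simp add: card_cartesian_product\<close>)
  finally show ?thesis by (simp add: mult.commute)
qed

end

theorem lemma1: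
  fixes G :: "('a, 'b) monoid_scheme"
    and m n p \<alpha> :: nat
    and lam :: "(nat \<Rightarrow> 'a option) \<Rightarrow> 'a \<times> nat"
  assumes "group G" and "cyclic_group G" and "order G = p" and "prime p"
    and "m \<ge> 1" and "n \<ge> 1" and "m \<ge> \<alpha>" and "\<alpha> \<ge> 1"
    and "lam \<in> nonzero_vectors G n \<rightarrow> carrier G \<times> {1..m}"
    and "equivariant G n lam"
    and "\<And>X1 X2. \<lbrakk>X1 \<in> nonzero_vectors G n; X2 \<in> nonzero_vectors G n; vec_subseteq G n X1 X2;
           snd (lam X1) = snd (lam X2); snd (lam X2) \<le> \<alpha>\<rbrakk>
         \<Longrightarrow> fst (lam X1) = fst (lam X2)"
    and "\<And>X :: nat \<Rightarrow> nat \<Rightarrow> 'a option.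
           \<lbrakk>\<forall>i \<in> {1..p}. X i \<in> nonzero_vectors G n;
            \<forall>i \<in> {1..<p}. vec_subseteq G n (X i) (X (Suc i));
            \<forall>i \<in> {1..p}. \<forall>j \<in> {1..p}. snd (lam (X i)) = snd (lam (X j));
            \<forall>i \<in> {1..p}. snd (lam (X i)) \<ge> \<alpha> + 1\<rbrakk>
         \<Longrightarrow> card {fst (lam (X i)) | i. i \<in> {1..p}} < p"
  shows "(\<exists>Z :: nat \<Rightarrow> nat \<Rightarrow> 'a option.
            (\<forall>i \<in> {1..n - \<alpha>}. Z i \<in> nonzero_vectors G n) \<and>
            (\<forall>i \<in> {1..<n - \<alpha>}. vec_subset G n (Z i) (Z (Suc i))) \<and>
            (\<forall>i \<in> {1..n - \<alpha>}. snd (lam (Z i)) \<ge> \<alpha> + 1) \<and>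
            (\<forall>i \<in> {1..n - \<alpha>}. \<forall>j \<in> {1..n - \<alpha>}. i \<noteq> j \<longrightarrow> lam (Z i) \<noteq> lam (Z j)) \<and>
            (\<forall>e \<in> carrier G.
               \<lfloor>real (n - \<alpha>) / real p\<rfloor> \<le> int (card {j \<in> {1..n - \<alpha>}. fst (lam (Z j)) = e}) \<and>
               int (card {j \<in> {1..n - \<alpha>}. fst (lam (Z j)) = e}) \<le> \<lceil>real (n - \<alpha>) / real p\<rceil>))
         \<and> int n - int \<alpha> \<le> (int p - 1) * (int m - int \<alpha>)"
proof (cases "\<alpha> < n")
  case False
  have "int p - 1 \<ge> 0" using prime_ge_2_nat[OF \<open>prime p\<close>] by simp
  then have "(int p - 1) * (int m - int \<alpha>) \<ge> 0" using \<open>m \<ge> \<alpha>\<close> by simp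
  then have "int n - int \<alpha> \<le> (int p - 1) * (int m - int \<alpha>)" using False by linarith
  moreover have "n - \<alpha> = 0" using False by simp
  ultimately show ?thesis by simp
next
  case True
  interpret signed_labelling G m n p \<alpha> lam
    by (intro signed_labelling.intro signed_labelling_axioms.intro assms(1-4,9-12)) assumption+
  let ?N = "n - \<alpha>"
  obtain V where V: "vector_chain G n V" "?N \<le> balanced_size (carrier G) (high_labels \<alpha> (lam ` V))"
    using ex_large_chain[OF True] by blast
  let ?H = "high_labels \<alpha> (lam ` V)"
  have "finite ?H" using V(1) by (simp add: vector_chain_def high_labels_def)
  then obtain B where B: "B \<subseteq> ?H" "card B = ?N"
    and bal: "\<And>e. e \<in> carrier G \<Longrightarrow> ?N div p \<le> card (B `` {e}) \<and>
           card (B `` {e}) \<le> ?N div p + of_bool (?N mod p \<noteq> 0)"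
    using ex_balanced_subset[OF finite_carrier _ _ V(2)] card_carrier by auto
  have "B \<subseteq> lam ` V" using B(1) by (auto simp: high_labels_def)
  from enumerate_chain_by_labels[OF V(1) this B(2)]
  obtain Z where Z: "\<forall>i \<in> {1..?N}. Z i \<in> V" "\<forall>i \<in> {1..<?N}. vec_subset G n (Z i) (Z (Suc i))"
    and bij: "bij_betw (\<lambda>i. lam (Z i)) {1..?N} B" by blast
  have im: "lam (Z i) \<in> B" if "i \<in> {1..?N}" for i using bij that by (auto simp: bij_betw_def)
  have inj: "inj_on (\<lambda>i. lam (Z i)) {1..?N}" using bij by (simp add: bij_betw_def)
  \<comment> \<open>labels along \<open>Z\<close> are distinct, so the vectors of sign \<open>e\<close> correspond to the elements of the fibre of \<open>B\<close> over \<open>e\<close>\<close>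
  have card_eq: "card {j \<in> {1..?N}. fst (lam (Z j)) = e} = card (B `` {e})" for e
  proof (rule bij_betw_same_card)
    let ?J = "{j \<in> {1..?N}. fst (lam (Z j)) = e}"
    have "inj_on (\<lambda>j. snd (lam (Z j))) ?J"
    proof (rule inj_onI)
      fix x y assume xy: "x \<in> ?J" "y \<in> ?J" "snd (lam (Z x)) = snd (lam (Z y))"
      then have "lam (Z x) = lam (Z y)" by (intro prod_eqI) auto
      then show "x = y" using inj_onD[OF inj] xy(1,2) by simp
    qed
    moreover have "(\<lambda>j. snd (lam (Z j))) ` ?J = B `` {e}"
    proof
      show "(\<lambda>j. snd (lam (Z j))) ` ?J \<subseteq> B `` {e}"
      proof (rule image_subsetI)
        fix j assume j: "j \<in> ?J"
        then have "lam (Z j) \<in> B" "lam (Z j) = (e, snd (lam (Z j)))" using im by (auto simp: prod_eq_iff)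
        then show "snd (lam (Z j)) \<in> B `` {e}" by (metis ImageI singletonI)
      qed
      show "B `` {e} \<subseteq> (\<lambda>j. snd (lam (Z j))) ` ?J"
      proof
        fix x assume "x \<in> B `` {e}"
        then have "(e, x) \<in> (\<lambda>i. lam (Z i)) ` {1..?N}" using bij by (simp add: bij_betw_def)
        then obtain j where "j \<in> {1..?N}" "lam (Z j) = (e, x)" by auto
        then show "x \<in> (\<lambda>j. snd (lam (Z j))) ` ?J" by (intro image_eqI[of _ _ j]) auto
      qed
    qed
    ultimately show "bij_betw (\<lambda>j. snd (lam (Z j))) ?J (B `` {e})" by (simp add: bij_betw_def)
  qed
  have floor: "\<lfloor>real ?N / real p\<rfloor> = int (?N div p)" by (rule floor_divide_of_nat_eq)
  have ceiling: "int (?N div p + of_bool (?N mod p \<noteq> 0)) \<le> \<lceil>real ?N / real p\<rceil>"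
  proof (cases "?N mod p = 0")
    case True
    then show ?thesis using floor floor_le_ceiling[of "real ?N / real p"] by simp
  next
    case False
    have "real ?N = real p * real (?N div p) + real (?N mod p)"
      by (metis mult_div_mod_eq of_nat_add of_nat_mult)
    moreover have "real p > 0" "real (?N mod p) > 0" using p_ge_2 False by auto
    ultimately have "real (?N div p) < real ?N / real p" by (simp add: field_simps)
    then have "int (?N div p) < \<lceil>real ?N / real p\<rceil>"
      by (simp only: less_ceiling_iff of_int_of_nat_eq)
    then show ?thesis using False by simp
  qed
  have "?N \<le> (p - 1) * (m - \<alpha>)" using card_high_labels_le[OF V(1) B(1) \<open>m \<ge> \<alpha>\<close>] B(2) by simp
  then have "int ?N \<le> int ((p - 1) * (m - \<alpha>))" by (simp only: of_nat_le_iff)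
  then have "int n - int \<alpha> \<le> (int p - 1) * (int m - int \<alpha>)"
    using True \<open>m \<ge> \<alpha>\<close> p_ge_2 by (simp add: of_nat_diff)
  moreover have "\<forall>i \<in> {1..?N}. Z i \<in> nonzero_vectors G n"
    using Z(1) V(1) unfolding vector_chain_def by blast
  moreover have "\<forall>i \<in> {1..?N}. snd (lam (Z i)) \<ge> \<alpha> + 1"
    using im B(1) by (fastforce simp: high_labels_def)
  moreover have "\<forall>i \<in> {1..?N}. \<forall>j \<in> {1..?N}. i \<noteq> j \<longrightarrow> lam (Z i) \<noteq> lam (Z j)"
    using inj by (auto simp: inj_on_def)
  moreover have "\<forall>e \<in> carrier G.
      \<lfloor>real ?N / real p\<rfloor> \<le> int (card {j \<in> {1..?N}. fst (lam (Z j)) = e}) \<and>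
      int (card {j \<in> {1..?N}. fst (lam (Z j)) = e}) \<le> \<lceil>real ?N / real p\<rceil>"
    unfolding card_eq floor using bal ceiling by (meson of_nat_mono order_trans)
  ultimately show ?thesis using Z(2) by blast
qed

end
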